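(* Let $\tau$ be an admissible transportation cost and let $\mu_+,\mu_-$ be nonnegative finite Borel measures on $\mathbb{R}^n$ with $\mu_+(\mathbb{R}^n)=\mu_-(\mathbb{R}^n)$ and bounded support, and let the reference space satisfy $\mathbb P(\Gamma)=\mu_+(\mathbb{R}^n)$. Then there exists an irrigation pattern $\chi$ with $J^{\tau,\mu_+,\mu_-}[\chi]<\infty$.
   Context: Transportation cost: $\tau:[0,\infty)\to[0,\infty)$, $\tau(0)=0$, $\tau(w)>0$ for $w>0$, non-decreasing, subadditive, lower semi-continuous; admissible if $\tau\le\beta$ for a concave $\beta:[0,\infty)\to[0,\infty)$ with $\int_0^1\beta(w)w^{-(2-1/n)}dw<\infty$. A reference space $(\Gamma,\mathcal B(\Gamma),\mathbb P)$ is a complete separable uncountable metric space with a positive finite atomless Borel measure $\mathbb P$. $I=[0,1]$. An irrigation pattern is a measurable $\chi:\Gamma\times I\to\mathbb{R}^n$ with $\chi_p=\chi(p,\cdot)$ absolutely continuous for $\mathbb P$-a.e. $p$; $\mu_\pm^\chi$ are the pushforwards of $\mathbb P$ under $p\mapsto\chi(p,0)$ resp. $\chi(p,1)$. $m_\chi(x)=\mathbb P(\{q:x\in\chi_q(I)\})$; $r^\tau(w)=\tau(w)/w$ ($w>0$), $r^\tau(0)=\lim_{w\downarrow0}\tau(w)/w$; $J^\tau(\chi)=\int_{\Gamma\times I}r^\tau(m_\chi(\chi(p,t)))|\dot\chi(p,t)|\,d\mathbb P\,dt$; $J^{\tau,\mu_+,\mu_-}[\chi]=J^\tau(\chi)$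 if $\mu_\pm^\chi=\mu_\pm$ and $+\infty$ otherwise. *)

theory Defs
  imports "HOL-Analysis.Analysis"
begin

definition lsc_on_nonneg :: "(real \<Rightarrow> real) \<Rightarrow> bool" where
  "lsc_on_nonneg f \<longleftrightarrow>
     (\<forall>a. openin (top_of_set {0..}) {w \<in> {0..}. a < f w})"

definition transportation_cost :: "(real \<Rightarrow> real) \<Rightarrow> bool" where
  "transportation_cost \<tau> \<longleftrightarrow>
     \<tau> 0 = 0 \<and> (\<forall>w>0. \<tau> w > 0) \<and> (\<forall>w\<ge>0. \<tau> w \<ge> 0) \<and>
     mono_on {0..} \<tau> \<and>
     (\<forall>a\<ge>0. \<forall>b\<ge>0. \<tau> (a + b) \<le> \<tau> a + \<tau> b) \<and>
     lsc_on_nonneg \<tau>"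

definition admissible_cost :: "nat \<Rightarrow> (real \<Rightarrow> real) \<Rightarrow> bool" where
  "admissible_cost n \<tau> \<longleftrightarrow> transportation_cost \<tau> \<and>
     (\<exists>\<beta>. concave_on {0..} \<beta> \<and> (\<forall>w\<ge>0. \<beta> w \<ge> 0) \<and> (\<forall>w\<ge>0. \<tau> w \<le> \<beta> w) \<and>
          (\<integral>\<^sup>+ w \<in> {0<..1}. ennreal (\<beta> w * w powr (- (2 - 1 / real n))) \<partial>lborel) < \<infinity>)"

definition reference_space :: "'g::{polish_space,metric_space} measure \<Rightarrow> bool" where
  "reference_space P \<longleftrightarrow> uncountable (UNIV :: 'g set) \<and>
     sets P = sets borel \<and> 0 < emeasure P UNIV \<and> emeasure P UNIV < \<infinity> \<and>
     (\<forall>x. emeasure P {x} = 0)"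

definition abs_cont_01 :: "(real \<Rightarrow> 'a::real_normed_vector) \<Rightarrow> bool" where
  "abs_cont_01 f \<longleftrightarrow>
     (\<forall>\<epsilon>>0. \<exists>\<delta>>0. \<forall>S. finite S \<and> S \<subseteq> {(a, b). 0 \<le> a \<and> a < b \<and> b \<le> 1} \<and>
         disjoint_family_on (\<lambda>(a, b). {a<..<b}) S \<and> (\<Sum>(a, b)\<in>S. b - a) < \<delta> \<longrightarrow>
         (\<Sum>(a, b)\<in>S. norm (f b - f a)) < \<epsilon>)"

abbreviation unit_interval_measure :: "real measure" where
  "unit_interval_measure \<equiv> restrict_space lborel {0..1}"

definition irrigation_pattern :: "'g measure \<Rightarrow> ('g \<times> real \<Rightarrow> 'a::euclidean_space) \<Rightarrow> bool" where
  "irrigation_pattern P \<gamma> \<longleftrightarrow>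
     \<gamma> \<in> borel_measurable (P \<Otimes>\<^sub>M unit_interval_measure) \<and>
     (AE p in P. abs_cont_01 (\<lambda>t. \<gamma> (p, t)))"

definition mu_plus :: "'g measure \<Rightarrow> ('g \<times> real \<Rightarrow> 'a::euclidean_space) \<Rightarrow> 'a measure" where
  "mu_plus P \<gamma> = distr P borel (\<lambda>p. \<gamma> (p, 0))"

definition mu_minus :: "'g measure \<Rightarrow> ('g \<times> real \<Rightarrow> 'a::euclidean_space) \<Rightarrow> 'a measure" where
  "mu_minus P \<gamma> = distr P borel (\<lambda>p. \<gamma> (p, 1))"

definition multiplicity_pat :: "'g measure \<Rightarrow> ('g \<times> real \<Rightarrow> 'a) \<Rightarrow> 'a \<Rightarrow> real" where
  "multiplicity_pat P \<gamma> x = measure P {q \<in> space P. x \<in> (\<lambda>t. \<gamma> (q, t)) ` {0..1}}"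

text \<open>r^tau, valued in [0,infinity] since the limit at 0 may be infinite.\<close>
definition r_tau :: "(real \<Rightarrow> real) \<Rightarrow> real \<Rightarrow> ennreal" where
  "r_tau \<tau> w = (if w > 0 then ennreal (\<tau> w / w)
                 else Lim (at_right 0) (\<lambda>v. ennreal (\<tau> v / v)))"

definition J_tau :: "(real \<Rightarrow> real) \<Rightarrow> 'g measure \<Rightarrow> ('g \<times> real \<Rightarrow> 'a::euclidean_space) \<Rightarrow> ennreal" where
  "J_tau \<tau> P \<gamma> =
     (\<integral>\<^sup>+ (p, t). r_tau \<tau> (multiplicity_pat P \<gamma> (\<gamma> (p, t))) *
          ennreal (norm (vector_derivative (\<lambda>s. \<gamma> (p, s)) (at t within {0..1})))
        \<partial>(P \<Otimes>\<^sub>M unit_interval_measure))"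

definition J_tau_bd :: "(real \<Rightarrow> real) \<Rightarrow> 'a measure \<Rightarrow> 'a measure \<Rightarrow> 'g measure \<Rightarrow>
    ('g \<times> real \<Rightarrow> 'a::euclidean_space) \<Rightarrow> ennreal" where
  "J_tau_bd \<tau> mp mm P \<gamma> =
     (if mu_plus P \<gamma> = mp \<and> mu_minus P \<gamma> = mm then J_tau \<tau> P \<gamma> else \<infinity>)"

definition bounded_support :: "'a::euclidean_space measure \<Rightarrow> bool" where
  "bounded_support \<mu> \<longleftrightarrow> (\<exists>R. emeasure \<mu> (UNIV - cball 0 R) = 0)"

end

theory Submission
  imports Defs "HOL-Probability.Weak_Convergence"
begin

text \<open>
  Since \<open>P\<close> is atomless, there are measurable maps from the reference space to the supports of the two
  measures that transport \<open>P\<close> to them. Each particle travels from its starting point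
  down a tree of corners of nested dyadic cubes to a common root, and then up the analogous tree
  to its end point. On the edge leading to a level \<open>k\<close> cube of mass \<open>m\<close> the multiplicity is at least \<open>m\<close>,
  and since \<open>\<beta> w / w\<close> is nonincreasing, the edge costs at most a constant times \<open>2 ^ -k * \<beta> m\<close>. Concavity of \<open>\<beta>\<close> bounds the sum
  of \<open>\<beta> m\<close> over the \<open>O (2 ^ (n k))\<close> cubes of level \<open>k\<close> by a constant times \<open>2 ^ (n k) * \<beta> (2 ^ -(n k))\<close>, and
  the resulting series over \<open>k\<close> is dominated by the admissibility integral.
\<close>

text \<open>A corner of level \<open>k + 1\<close> determines the corner of level \<open>k\<close>,
  so particles that share a cell also share the curve from the root to its corner. This is what
  bounds a multiplicity from below by a cell mass.

  Turning that into an upper bound on the cost needs a nonincreasing cost per unit mass.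
  Subadditivity alone does not make \<open>\<tau> w / w\<close> monotone, hence the passage to
  \<open>\<beta>\<close>.

  The exponent of the admissibility integral comes from the geometry of the levels. With
  \<open>n\<close> the dimension and \<open>w = 2 ^ -(n k)\<close>, one has
  \<open>2 ^ -k = w powr (1 / n)\<close>, so level \<open>k\<close> costs a constant times
  \<open>\<beta> w * w powr (1 / n - 1)\<close>. This is the integrand
  \<open>\<beta> w * w powr (1 / n - 2)\<close> times \<open>w\<close>, and \<open>w\<close> is
  comparable to the length of the interval between consecutive values of \<open>w\<close>.

  Every tree has infinitely many levels, but a curve must run through them in finite time and stay
  absolutely continuous. The time allotted to a level is therefore comparable to the length of its
  edges.\<close>

section \<open>Transport maps from atomless measures\<close>

text \<open>Base 3 with digits 0 and 1 only, so that expansions are unique.\<close>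

definition ternary_code :: "nat set \<Rightarrow> real" where
  "ternary_code A = (\<Sum>m. indicator A m * (1/3) ^ m)"

text \<open>Multiplying by \<open>3 ^ j\<close> moves digit \<open>j\<close> to the units place. The
  earlier digits then contribute the multiple \<open>3 * z\<close> of 3, and the later ones at most
  1/3 + 1/9 + ... = 1/2, hence nothing to the floor.\<close>

lemma floor_ternary_code_mod_3:
  "\<lfloor>3 ^ j * ternary_code A\<rfloor> mod 3 = (if j \<in> A then 1 else 0)"
proof -
  let ?f = "\<lambda>m. indicator A m * (1/3::real) ^ m"
  have geo: "summable (\<lambda>m. (1/3::real) ^ m)" "(\<Sum>m. (1/3::real) ^ m) = 3/2"
    by (simp_all add: summable_geometric suminf_geometric)
  have sf: "summable ?f"
    by (rule summable_comparison_test'[OF geo(1), of 0]) (simp add: indicator_def)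
  define t where "t = 3 ^ j * (\<Sum>n. ?f (n + Suc j))"
  define z where "z = (\<Sum>i<j. if i \<in> A then 3 ^ (j - Suc i) else (0::int))"
  define e :: int where "e = (if j \<in> A then 1 else 0)"
  have st: "summable (\<lambda>n. ?f (n + Suc j))"
    using sf by (rule summable_ignore_initial_segment)
  have t0: "0 \<le> t"
    unfolding t_def by (intro mult_nonneg_nonneg suminf_nonneg[OF st]) auto
  have "(\<Sum>n. ?f (n + Suc j)) \<le> (\<Sum>n. (1/3) ^ Suc j * (1/3::real) ^ n)"
    by (intro suminf_le st summable_mult geo(1)) (simp add: indicator_def power_add)
  also have "\<dots> = (1/3) ^ Suc j * (3/2)"
    using geo(2) by (subst suminf_mult[OF geo(1)]) simp
  finally have "t \<le> 3 ^ j * ((1/3) ^ Suc j * (3/2))"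
    unfolding t_def by (intro mult_left_mono) auto
  also have "\<dots> = 1/2"
    by (simp add: power_divide)
  finally have t1: "t < 1" by simp
  have "3 ^ j * (\<Sum>i<j. ?f i) = (\<Sum>i<j. 3 * of_int (if i \<in> A then 3 ^ (j - Suc i) else 0))"
    unfolding sum_distrib_left
  proof (rule sum.cong)
    fix i assume "i \<in> {..<j}"
    then obtain d where j: "j = Suc (i + d)"
      by (auto simp: less_iff_Suc_add)
    show "3 ^ j * ?f i = 3 * of_int (if i \<in> A then 3 ^ (j - Suc i) else 0)"
      unfolding j by (simp add: power_add power_divide)
  qed simp
  also have "\<dots> = of_int (3 * z)"
    unfolding z_def of_int_mult of_int_sum sum_distrib_left by simp
  finally have z: "3 ^ j * (\<Sum>i<j. ?f i) = of_int (3 * z)" .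
  have "3 ^ j * ternary_code A = of_int (3 * z + e) + t"
    unfolding ternary_code_def suminf_split_initial_segment[OF sf, of "Suc j"] distrib_left
    using z by (simp add: t_def e_def power_divide algebra_simps)
  then have "\<lfloor>3 ^ j * ternary_code A\<rfloor> = 3 * z + e"
    using t0 t1 by linarith
  then show ?thesis
    by (simp add: e_def)
qed

lemma inj_ternary_code: "inj ternary_code"
proof (rule injI)
  fix A B assume "ternary_code A = ternary_code B"
  then have "(if j \<in> A then 1 else 0 :: int) = (if j \<in> B then 1 else 0)" for j
    by (simp flip: floor_ternary_code_mod_3)
  then show "A = B"
    by (auto split: if_splits) (metis zero_neq_one)+
qed

section \<open>Measurable codes of points by real numbers\<close>

lemma borel_measurable_ternary_code:
  assumes [measurable]: "\<And>m. {x \<in> space M. P x m} \<in> sets M"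
  shows "(\<lambda>x. ternary_code {m. P x m}) \<in> borel_measurable M"
proof -
  have "(\<lambda>x. ternary_code {m. P x m}) = (\<lambda>x. \<Sum>m. (if P x m then 1 else 0) * (1/3) ^ m)"
    by (auto simp: ternary_code_def indicator_def fun_eq_iff intro!: suminf_cong)
  then show ?thesis by simp
qed

text \<open>A countable basis of a Hausdorff space separates points, so the indices of the basic
  open sets around \<open>p\<close> identify \<open>p\<close>. Injectivity is what keeps the image
  of an atomless measure on the line atomless.\<close>

lemma ex_inj_borel_measurable_real:
  "\<exists>f :: 'g::{second_countable_topology, t2_space} \<Rightarrow> real. f \<in> borel_measurable borel \<and> inj f"
proof -
  obtain B :: "'g set set" where B: "countable B" "topological_basis B"
    using ex_countable_basis by auto
  let ?U = "from_nat_into B"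
  have ne: "B \<noteq> {}"
    using topological_basisE[OF B(2) open_UNIV UNIV_I] by blast
  have op: "open (?U m)" for m
    using from_nat_into[OF ne] topological_basis_open[OF B(2)] by blast
  have "inj (\<lambda>p. {m. p \<in> ?U m})"
  proof (rule injI, rule ccontr)
    fix p q assume eq: "{m. p \<in> ?U m} = {m. q \<in> ?U m}" and "p \<noteq> q"
    then obtain V where V: "open V" "p \<in> V" "q \<notin> V"
      using hausdorff[of p q] by blast
    then obtain W where W: "W \<in> B" "p \<in> W" "W \<subseteq> V"
      using topological_basisE[OF B(2)] by metis
    then obtain m where "?U m = W"
      using from_nat_into_surj[OF B(1)] by metis
    with eq W V show False by blast
  qed
  then have "inj (\<lambda>p. ternary_code {m. p \<in> ?U m})"
    using inj_compose[OF inj_ternary_code] by (simp add: comp_def)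
  moreover have "(\<lambda>p. ternary_code {m. p \<in> ?U m}) \<in> borel_measurable borel"
    using op by (intro borel_measurable_ternary_code) auto
  ultimately show ?thesis by blast
qed

text \<open>Each digit equals \<open>\<lfloor>2 ^ Suc k * u\<rfloor> - 2 * \<lfloor>2 ^ k *
  u\<rfloor>\<close>, so the series telescopes along the truncations
  \<open>\<lfloor>2 ^ k * u\<rfloor> / 2 ^ k\<close>, which start at 0 and tend to
  \<open>u\<close>.\<close>

lemma binary_expansion_sums:
  fixes u :: real
  assumes "0 \<le> u" "u < 1"
  shows "(\<lambda>k. (if odd \<lfloor>2 ^ Suc k * u\<rfloor> then 1 else 0) * (1/2) ^ Suc k) sums u"
proof -
  let ?f = "\<lambda>k. of_int \<lfloor>2 ^ k * u\<rfloor> / 2 ^ k :: real"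
  have "?f \<longlonglongrightarrow> u"
  proof (rule tendsto_sandwich)
    show "eventually (\<lambda>k. u - (1/2) ^ k \<le> ?f k) sequentially"
    proof (rule always_eventually, rule allI)
      fix k
      have "2 ^ k * u - 1 \<le> of_int \<lfloor>2 ^ k * u\<rfloor>"
        by linarith
      then have "(2 ^ k * u - 1) / 2 ^ k \<le> ?f k"
        by (intro divide_right_mono) auto
      then show "u - (1/2) ^ k \<le> ?f k"
        by (simp add: diff_divide_distrib power_divide)
    qed
    show "eventually (\<lambda>k. ?f k \<le> u) sequentially"
      by (rule always_eventually) (simp add: divide_le_eq mult.commute)
    have "(\<lambda>k. u - (1/2) ^ k) \<longlonglongrightarrow> u - 0"
      by (intro tendsto_intros LIMSEQ_power_zero) auto
    then show "(\<lambda>k. u - (1/2) ^ k) \<longlonglongrightarrow> u" by simp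
  qed simp
  then have "(\<lambda>k. ?f (Suc k) - ?f k) sums (u - ?f 0)"
    by (rule telescope_sums)
  moreover have "?f 0 = 0"
    using assms by (simp add: floor_eq_iff)
  moreover have "?f (Suc k) - ?f k = (if odd \<lfloor>2 ^ Suc k * u\<rfloor> then 1 else 0) * (1/2) ^ Suc k" for k
  proof -
    define y where "y = 2 ^ k * u"
    have "\<lfloor>2 * y\<rfloor> = 2 * \<lfloor>y\<rfloor> + (if odd \<lfloor>2 * y\<rfloor> then 1 else 0)"
    proof -
      have "\<lfloor>2 * y\<rfloor> = 2 * \<lfloor>y\<rfloor> \<or> \<lfloor>2 * y\<rfloor> = 2 * \<lfloor>y\<rfloor> + 1"
        by linarith
      then show ?thesis by auto
    qed
    then have "real_of_int \<lfloor>2 * y\<rfloor> = 2 * of_int \<lfloor>y\<rfloor> + (if odd \<lfloor>2 * y\<rfloor> then 1 else 0)"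
      by (auto split: if_splits)
    then have "of_int \<lfloor>2 * y\<rfloor> / (2 * 2 ^ k) - real_of_int \<lfloor>y\<rfloor> / 2 ^ k
        = (if odd \<lfloor>2 * y\<rfloor> then 1 else 0) / (2 * 2 ^ k)"
      by (simp add: field_simps)
    then show ?thesis
      by (simp add: y_def power_divide mult.assoc)
  qed
  ultimately show ?thesis by (simp only: diff_0_right)
qed

text \<open>\<open>h\<close> interleaves the binary digits of all coordinates and codes them in base
  3; \<open>g\<close> reads the base 3 digits and reassembles the coordinates. A measure on the ball
  can thus be moved to the line by \<open>h\<close> and recovered by \<open>g\<close>.\<close>

lemma ex_borel_measurable_left_inverse_on_cball:
  fixes R :: real
  obtains h :: "'a::euclidean_space \<Rightarrow> real" and g :: "real \<Rightarrow> 'a"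
  where "h \<in> borel_measurable borel" "g \<in> borel_measurable borel"
    "\<And>x. x \<in> cball 0 R \<Longrightarrow> g (h x) = x"
proof -
  \<comment> \<open>The extra 1 keeps the rescaled coordinates \<open>u i x\<close> strictly below
    1, where \<open>binary_expansion_sums\<close> applies.\<close>
  define L where "L = \<bar>R\<bar> + 1"
  have L: "0 < L" by (simp add: L_def)
  define e :: "'a \<Rightarrow> nat" where "e = to_nat_on Basis"
  have e: "inj_on e Basis"
    unfolding e_def by (intro inj_on_to_nat_on countable_finite finite_Basis)
  define u :: "'a \<Rightarrow> 'a \<Rightarrow> real" where "u i x = (x \<bullet> i + L) / (2 * L)" for i x
  define D where "D x = {m. \<exists>i\<in>Basis. \<exists>k. m = prod_encode (e i, k) \<and> odd \<lfloor>2 ^ Suc k * u i x\<rfloor>}" for x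
  define dig where "dig m y = (if \<lfloor>3 ^ m * y\<rfloor> mod 3 = 1 then 1 else 0 :: real)" for m and y :: real
  define h where "h x = ternary_code (D x)" for x
  define g where "g y = (\<Sum>i\<in>Basis. (2 * L * (\<Sum>k. dig (prod_encode (e i, k)) y * (1/2) ^ Suc k) - L) *\<^sub>R i)" for y
  have "h \<in> borel_measurable borel"
    unfolding h_def D_def
  proof (rule borel_measurable_ternary_code)
    fix m
    have [measurable]: "u i \<in> borel_measurable borel" for i
      unfolding u_def by measurable
    have "Measurable.pred borel (\<lambda>x. \<exists>i\<in>Basis. \<exists>k. m = prod_encode (e i, k) \<and> odd \<lfloor>2 ^ Suc k * u i x\<rfloor>)"
      by measurable
    then show "{x \<in> space borel. \<exists>i\<in>Basis. \<exists>k. m = prod_encode (e i, k) \<and> odd \<lfloor>2 ^ Suc k * u i x\<rfloor>} \<in> sets borel"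
      by (simp add: pred_def)
  qed
  moreover have "g \<in> borel_measurable borel"
    unfolding g_def dig_def by measurable
  moreover have "g (h x) = x" if "x \<in> cball 0 R" for x
  proof -
    have "(2 * L * (\<Sum>k. dig (prod_encode (e i, k)) (h x) * (1/2) ^ Suc k) - L) = x \<bullet> i" if i: "i \<in> Basis" for i
    proof -
      have "\<bar>x \<bullet> i\<bar> \<le> \<bar>R\<bar>"
        using \<open>x \<in> cball 0 R\<close> Basis_le_norm[OF i, of x] by auto
      then have u01: "0 \<le> u i x" "u i x < 1"
        using L by (auto simp: u_def L_def field_simps)
      have "dig (prod_encode (e i, k)) (h x) = (if odd \<lfloor>2 ^ Suc k * u i x\<rfloor> then 1 else 0)" for k
      proof -
        have "prod_encode (e i, k) \<in> D x \<longleftrightarrow> odd \<lfloor>2 ^ Suc k * u i x\<rfloor>"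
          using i e by (auto simp: D_def prod_encode_eq inj_on_eq_iff)
        then show ?thesis
          by (simp add: dig_def h_def floor_ternary_code_mod_3)
      qed
      then have "(\<Sum>k. dig (prod_encode (e i, k)) (h x) * (1/2) ^ Suc k) = u i x"
        using sums_unique[OF binary_expansion_sums[OF u01]] by simp
      then show ?thesis
        using L by (simp add: u_def)
    qed
    then show ?thesis
      by (simp add: g_def euclidean_representation)
  qed
  ultimately show ?thesis
    by (rule that)
qed

text \<open>Without atoms the cumulative distribution function is continuous, so it attains every
  value in (0, 1). The sublevel set at \<open>c\<close> is squeezed between half-lines
  \<open>{..s}\<close> where the function has a value \<open>c'\<close> just below or just above
  \<open>c\<close>. Using \<open>c'\<close> instead of \<open>c\<close> covers the end values 0 and
  1, which need not be attained.\<close>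

lemma (in real_distribution) prob_cdf_le:
  assumes atomless: "\<And>x. measure M {x} = 0" and c: "0 \<le> c" "c \<le> 1"
  shows "measure M {y. cdf M y \<le> c} = c"
proof -
  interpret cdf_distribution M
    by unfold_locales
  have [measurable]: "{y. C y \<le> c} \<in> sets borel" for c
    by measurable
  have ex: "\<exists>s. C s = c" if c: "0 < c" "c < 1" for c
  proof -
    obtain a where a: "C a < c"
      by (metis eventually_happens' trivial_limit_at_bot_linorder order_tendstoD(2) bot c(1))
    obtain b where b: "c < C b"
      by (metis eventually_happens' trivial_limit_at_top_linorder order_tendstoD(1) top c(2))
    have "a \<le> b"
      using a b cdf_nondecreasing[of b a] by linarith
    then show ?thesis
      using IVT[of C a c b] a b isCont_cdf atomless by auto
  qed
  have mle: "measure M A \<le> measure M B" if "A \<subseteq> B" "B \<in> sets borel" for A B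
    using that by (intro finite_measure_mono) auto
  have lower: "c' \<le> measure M {y. C y \<le> c}" if c': "c' \<le> c" "0 < c'" "c' < 1" for c' c
  proof -
    obtain s where s: "C s = c'" using ex[OF c'(2,3)] by blast
    have "c' = measure M {..s}" using s by (simp add: cdf_def2)
    also have "\<dots> \<le> measure M {y. C y \<le> c}"
      using s c'(1) by (intro mle) (auto dest: cdf_nondecreasing)
    finally show ?thesis .
  qed
  have upper: "measure M {y. C y \<le> c} \<le> c'" if c': "c < c'" "0 < c'" "c' < 1" for c' c
  proof -
    obtain s where s: "C s = c'" using ex[OF c'(2,3)] by blast
    have "measure M {y. C y \<le> c} \<le> measure M {..s}"
    proof (rule mle)
      show "{y. C y \<le> c} \<subseteq> {..s}"
      proof
        fix y assume "y \<in> {y. C y \<le> c}"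
        then show "y \<in> {..s}"
          using s c'(1) cdf_nondecreasing[of s y] by (cases "s \<le> y") auto
      qed
    qed simp
    then show ?thesis using s by (simp add: cdf_def2)
  qed
  show ?thesis
  proof (rule antisym)
    show "measure M {y. C y \<le> c} \<le> c"
    proof (rule ccontr)
      assume "\<not> measure M {y. C y \<le> c} \<le> c"
      then obtain c' where c': "c < c'" "c' < measure M {y. C y \<le> c}"
        using dense not_le by metis
      moreover have "c' < 1"
        using c'(2) prob_le_1[of "{y. C y \<le> c}"] by linarith
      ultimately show False
        using upper[of c c'] c by linarith
    qed
    show "c \<le> measure M {y. C y \<le> c}"
    proof (rule ccontr)
      assume "\<not> c \<le> measure M {y. C y \<le> c}"
      then obtain c' where c': "measure M {y. C y \<le> c} < c'" "c' < c"
        using dense not_le by metis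
      have "0 < c'" using c'(1) measure_nonneg[of M "{y. C y \<le> c}"] by linarith
      with c' lower[of c' c] c show False by auto
    qed
  qed
qed

text \<open>The cumulative distribution function of an atomless measure transports it to the uniform measure,
  which the quantile function of \<open>N\<close> transports to \<open>N\<close>.\<close>

lemma ex_transport_map_real:
  assumes M: "real_distribution M" and N: "real_distribution N"
    and atomless: "\<And>x. measure M {x} = 0"
  obtains T :: "real \<Rightarrow> real" where "T \<in> borel_measurable borel" "distr M borel T = N"
proof -
  interpret M: cdf_distribution M unfolding cdf_distribution_def by (rule M)
  interpret N: cdf_distribution N unfolding cdf_distribution_def by (rule N)
  \<comment> \<open>0 is a filler outside the open unit interval, where the quantile function is not
    controlled; \<open>M.C\<close> takes values there only on a null set.\<close>
  define Q where "Q w = (if w \<in> {0<..<1} then N.I w else 0)" for w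
  define T where "T y = Q (M.C y)" for y
  have [measurable]: "Q \<in> borel_measurable borel"
    using N.measurable_CI unfolding Q_def[abs_def]
    by (subst measurable_If_restrict_space_iff)
       (auto simp: greaterThanLessThan_def greaterThan_def lessThan_def Int_def)
  have T[measurable]: "T \<in> borel_measurable borel"
    unfolding T_def[abs_def] by measurable
  have "distr M borel T = N"
  proof (intro cdf_unique ext)
    show "real_distribution (distr M borel T)" by simp
    show "real_distribution N" by (rule N)
    fix x
    have 0: "measure M {y. M.C y \<le> 0} = 0"
      by (rule M.prob_cdf_le[OF atomless]) auto
    have ae0: "AE y in M. 0 < M.C y"
      using 0 by (intro AE_I[of _ _ "{y. M.C y \<le> 0}"]) (auto simp: M.emeasure_eq_measure)
    \<comment> \<open>This set misses \<open>{y. M.C y \<le> 1 - d}\<close>, which has measure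
      \<open>1 - d\<close>; afterwards \<open>d\<close> tends to 0.\<close>
    have "measure M {y. 1 \<le> M.C y} \<le> d" if "0 < d" "d < 1" for d
    proof -
      have "measure M {y. 1 \<le> M.C y} \<le> measure M (space M - {y. M.C y \<le> 1 - d})"
        using that by (intro M.finite_measure_mono) auto
      also have "\<dots> = d"
        using that M.prob_cdf_le[OF atomless, of "1 - d"] by (subst M.prob_compl) auto
      finally show ?thesis .
    qed
    then have "measure M {y. 1 \<le> M.C y} \<le> 0"
      using dense_ge_bounded[of 0 1 "measure M {y. 1 \<le> M.C y}"] by simp
    then have "measure M {y. 1 \<le> M.C y} = 0"
      by (simp add: measure_le_0_iff)
    then have ae1: "AE y in M. M.C y < 1"
      by (intro AE_I[of _ _ "{y. 1 \<le> M.C y}"]) (auto simp: M.emeasure_eq_measure)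
    have sT: "{y. T y \<le> x} \<in> sets M" by measurable
    have sC: "{y. M.C y \<le> N.C x} \<in> sets M" by measurable
    have ae: "AE y in M. y \<in> {y. T y \<le> x} \<longleftrightarrow> y \<in> {y. M.C y \<le> N.C x}"
        using ae0 ae1 
    proof eventually_elim
      case (elim y)
      have "N.I (M.C y) \<le> x \<longleftrightarrow> M.C y \<le> N.C x" using N.pseudoinverse[OF elim, of x] by blast
      then show ?case using elim unfolding T_def Q_def by simp
    qed
    have "cdf (distr M borel T) x = measure M (T -` {..x} \<inter> space M)"
      unfolding cdf_def by (rule measure_distr[OF M.measurable_finite_borel[OF T] atMost_borel])
    moreover have "T -` {..x} \<inter> space M = {y. T y \<le> x}"
      by (simp add: vimage_def)
    moreover have "measure M {y. T y \<le> x} = measure M {y. M.C y \<le> N.C x}"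
      by (rule M.finite_measure_eq_AE[OF ae sT sC])
    moreover have "measure M {y. M.C y \<le> N.C x} = N.C x"
      by (intro M.prob_cdf_le[OF atomless] N.cdf_nonneg N.cdf_bounded_prob)
    ultimately show "cdf (distr M borel T) x = N.C x" by metis
  qed
  with T show ?thesis by (rule that)
qed

text \<open>The map is \<open>g\<close> after \<open>S\<close> after \<open>f\<close>:
  \<open>f\<close> injects the reference space into the line without creating atoms,
  \<open>S\<close> transports on the line to the image of \<open>\<mu>\<close> under
  \<open>h\<close>, and \<open>g\<close> undoes \<open>h\<close> on the ball that carries
  \<open>\<mu>\<close>.\<close>

lemma ex_transport_map_prob:
  fixes P :: "'g::{second_countable_topology, t2_space} measure"
    and \<mu> :: "'a::euclidean_space measure"
  assumes P: "prob_space P" "sets P = sets borel" "\<And>x. emeasure P {x} = 0"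
    and \<mu>: "prob_space \<mu>" "sets \<mu> = sets borel" "AE x in \<mu>. x \<in> cball 0 R"
  obtains T where "T \<in> borel_measurable borel" "distr P borel T = \<mu>"
proof -
  interpret P: prob_space P by fact
  interpret \<mu>: prob_space \<mu> by fact
  note [measurable_cong] = P(2) \<mu>(2)
  have spP: "space P = UNIV" using sets_eq_imp_space_eq[OF P(2)] by simp
  obtain f :: "'g \<Rightarrow> real" where f[measurable]: "f \<in> borel_measurable borel" and "inj f"
    using ex_inj_borel_measurable_real by blast
  obtain h :: "'a \<Rightarrow> real" and g where [measurable]: "h \<in> borel_measurable borel"
    and g[measurable]: "g \<in> borel_measurable borel" and gh: "\<And>x. x \<in> cball 0 R \<Longrightarrow> g (h x) = x"
    using ex_borel_measurable_left_inverse_on_cball by blast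
  have "measure (distr P borel f) {y} = 0" for y
  proof -
    have "measure (distr P borel f) {y} = measure P (f -` {y})"
      by (subst measure_distr) (auto simp: spP)
    also have "f -` {y} = {} \<or> (\<exists>x. f -` {y} = {x})"
      using inj_vimage_singleton[OF \<open>inj f\<close>, of y] by (metis subset_singletonD subset_singleton_iff)
    then have "measure P (f -` {y}) = 0"
      using P(3) by (auto simp: measure_def)
    finally show ?thesis .
  qed
  then obtain S where [measurable]: "S \<in> borel_measurable borel"
    and S: "distr (distr P borel f) borel S = distr \<mu> borel h"
    by (rule ex_transport_map_real[of "distr P borel f" "distr \<mu> borel h", rotated 2]) auto
  have "distr P borel (\<lambda>p. g (S (f p))) = distr (distr (distr P borel f) borel S) borel g"
    by (simp add: distr_distr comp_def)
  also have "\<dots> = distr \<mu> borel (\<lambda>x. g (h x))"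
    by (simp add: S distr_distr comp_def)
  also have "\<dots> = distr \<mu> \<mu> (\<lambda>x. x)"
    using \<mu>(3) gh by (intro distr_cong_AE) (auto simp: \<mu>(2))
  also have "\<dots> = \<mu>" by simp
  finally show ?thesis
    by (intro that[of "\<lambda>p. g (S (f p))"]) auto
qed

lemma ex_transport_map:
  fixes P :: "'g::{second_countable_topology, t2_space} measure"
    and \<mu> :: "'a::euclidean_space measure"
  assumes P: "sets P = sets borel" "\<And>x. emeasure P {x} = 0"
    and mass: "emeasure P UNIV = emeasure \<mu> UNIV" "0 < emeasure P UNIV" "emeasure P UNIV < \<infinity>"
    and \<mu>: "sets \<mu> = sets borel" "emeasure \<mu> (UNIV - cball 0 R) = 0"
  obtains T where "T \<in> borel_measurable borel" "distr P borel T = \<mu>"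
    "\<And>p. T p \<in> cball 0 \<bar>R\<bar>"
proof -
  have spP: "space P = UNIV" and sp\<mu>: "space \<mu> = UNIV"
    using sets_eq_imp_space_eq[OF P(1)] sets_eq_imp_space_eq[OF \<mu>(1)] by simp_all
  note [measurable_cong] = P(1) \<mu>(1)
  define m where "m = emeasure P UNIV"
  have m: "0 < m" "m < \<infinity>" using mass by (auto simp: m_def)
  define c where "c = inverse m"
  have "m / m = 1"
    using m by (intro ennreal_divide_self) auto
  then have mc: "m * c = 1" "c * m = 1"
    by (simp_all add: c_def divide_ennreal_def mult.commute)
  have ps: "prob_space (scale_measure c P)" "prob_space (scale_measure c \<mu>)"
    using mc mass by (auto intro!: prob_spaceI simp: space_scale_measure spP sp\<mu> m_def)
  have ae: "AE x in scale_measure c \<mu>. x \<in> cball 0 R"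
    using \<mu> by (intro AE_I[of _ _ "UNIV - cball 0 R"]) auto
  have at: "emeasure (scale_measure c P) {x} = 0" for x
    using P(2) by simp
  obtain T0 where [measurable]: "T0 \<in> borel_measurable borel"
    and T0: "distr (scale_measure c P) borel T0 = scale_measure c \<mu>"
    using ex_transport_map_prob[OF ps(1) _ at ps(2) _ ae] P(1) \<mu>(1) by (metis sets_scale_measure)
  have d0: "distr P borel T0 = \<mu>"
  proof (rule measure_eqI)
    fix A assume "A \<in> sets (distr P borel T0)"
    then have A[measurable]: "A \<in> sets borel" by simp
    have "emeasure (distr (scale_measure c P) borel T0) A = c * emeasure P (T0 -` A)"
      by (subst emeasure_distr) (auto simp: space_scale_measure spP)
    then have "c * emeasure P (T0 -` A) = c * emeasure \<mu> A"
      by (simp add: T0)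
    then have "m * c * emeasure P (T0 -` A) = m * c * emeasure \<mu> A"
      by (simp add: mult.assoc)
    then show "emeasure (distr P borel T0) A = emeasure \<mu> A"
      by (simp add: mc emeasure_distr spP)
  qed (simp add: \<mu>)
  \<comment> \<open>\<open>T0\<close> is in the ball only almost everywhere. Redefining it as 0
    elsewhere gives a bound at every point, as the path estimates require.\<close>
  define T where "T p = (if norm (T0 p) \<le> R then T0 p else 0)" for p
  have T[measurable]: "T \<in> borel_measurable borel"
    unfolding T_def by measurable
  have "emeasure P {p. \<not> norm (T0 p) \<le> R} = emeasure (distr P borel T0) (UNIV - cball 0 R)"
    by (subst emeasure_distr) (auto simp: spP intro!: arg_cong[where f="emeasure P"])
  also have "\<dots> = 0" using \<mu>(2) d0 by simp
  finally have "AE p in P. norm (T0 p) \<le> R"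
    by (intro AE_I[of _ _ "{p. \<not> norm (T0 p) \<le> R}"]) auto
  then have "AE p in P. T p = T0 p"
    by eventually_elim (simp add: T_def)
  then have "distr P borel T = distr P borel T0"
    by (intro distr_cong_AE) auto
  then have "distr P borel T = \<mu>"
    using d0 by simp
  moreover have "T p \<in> cball 0 \<bar>R\<bar>" for p
    by (auto simp: T_def)
  ultimately show ?thesis
    using T that by blast
qed

section \<open>Dyadic paths\<close>

lemma floor_dyadic_diff: "\<bar>of_int \<lfloor>2 * y\<rfloor> - 2 * of_int \<lfloor>y\<rfloor>\<bar> \<le> (1::real)" for y :: real
proof -
  have "\<lfloor>2 * y\<rfloor> = 2 * \<lfloor>y\<rfloor> \<or> \<lfloor>2 * y\<rfloor> = 2 * \<lfloor>y\<rfloor> + 1"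
    by linarith
  then show ?thesis by auto
qed

text \<open>The lower corner of the level \<open>k\<close> dyadic cell of side \<open>L / 2 ^ k\<close> that contains \<open>x\<close>. Level 0 is
  replaced by the single root \<open>0\<close>, so that all paths start at the same point.\<close>

definition dyadic_corner :: "real \<Rightarrow> nat \<Rightarrow> 'a::euclidean_space \<Rightarrow> 'a" where
  "dyadic_corner L k x =
     (if k = 0 then 0 else \<Sum>i\<in>Basis. (L * of_int \<lfloor>2 ^ k * (x \<bullet> i) / L\<rfloor> / 2 ^ k) *\<^sub>R i)"

lemma dyadic_corner_0 [simp]: "dyadic_corner L 0 x = 0"
  by (simp add: dyadic_corner_def)

lemma inner_dyadic_corner:
  "i \<in> Basis \<Longrightarrow> 0 < k \<Longrightarrow> dyadic_corner L k x \<bullet> i = L * of_int \<lfloor>2 ^ k * (x \<bullet> i) / L\<rfloor> / 2 ^ k"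
  by (simp add: dyadic_corner_def)

lemma borel_measurable_dyadic_corner [measurable]:
  "dyadic_corner L k \<in> borel_measurable borel"
  unfolding dyadic_corner_def[abs_def] by measurable

text \<open>Since \<open>\<lfloor>u\<rfloor> = \<lfloor>2 * u\<rfloor> div 2\<close>, every corner
  has exactly one parent, and the corners form a tree.\<close>

lemma dyadic_corner_Suc_eqD:
  assumes L: "0 < L" and eq: "dyadic_corner L (Suc k) x = dyadic_corner L (Suc k) y"
  shows "dyadic_corner L k x = dyadic_corner L k y"
proof (cases "k = 0")
  case False
  have "dyadic_corner L k x \<bullet> i = dyadic_corner L k y \<bullet> i" if i: "i \<in> Basis" for i
  proof -
    define u where "u z = 2 ^ k * (z \<bullet> i) / L" for z
    have half: "\<lfloor>u z\<rfloor> = \<lfloor>2 * u z\<rfloor> div 2" for z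
      by linarith
    have "\<lfloor>2 * u x\<rfloor> = \<lfloor>2 * u y\<rfloor>"
      using arg_cong[OF eq, of "\<lambda>z. z \<bullet> i"] L i by (simp add: inner_dyadic_corner u_def mult.assoc)
    then have "\<lfloor>u x\<rfloor> = \<lfloor>u y\<rfloor>"
      by (simp add: half)
    then show ?thesis
      using False i by (simp add: inner_dyadic_corner u_def)
  qed
  then show ?thesis
    by (rule euclidean_eqI)
qed simp

lemma norm_dyadic_corner_Suc_diff:
  fixes x :: "'a::euclidean_space"
  assumes L: "0 < L" and x: "norm x < L"
  shows "norm (dyadic_corner L (Suc k) x - dyadic_corner L k x) \<le> real DIM('a) * L / 2 ^ k"
proof -
  have "\<bar>(dyadic_corner L (Suc k) x - dyadic_corner L k x) \<bullet> i\<bar> \<le> L / 2 ^ k" if i: "i \<in> Basis" for i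
  proof (cases "k = 0")
    case True
    \<comment> \<open>The first edge starts at the artificial root and not at a level 0 corner, so
      its length is controlled by \<open>norm x < L\<close> instead of by the halving of
      cells.\<close>
    have "\<bar>x \<bullet> i\<bar> < L"
      using Basis_le_norm[OF i, of x] x by simp
    then have "-2 \<le> 2 * (x \<bullet> i) / L" "2 * (x \<bullet> i) / L < 2"
      using L by (auto simp: field_simps)
    then have "-2 \<le> \<lfloor>2 * (x \<bullet> i) / L\<rfloor>" "\<lfloor>2 * (x \<bullet> i) / L\<rfloor> < 2"
      by (simp_all add: le_floor_iff floor_less_iff)
    then have "\<bar>real_of_int \<lfloor>2 * (x \<bullet> i) / L\<rfloor>\<bar> \<le> 2"
      by linarith
    then have "L * \<bar>real_of_int \<lfloor>2 * (x \<bullet> i) / L\<rfloor>\<bar> \<le> L * 2"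
      using L by (intro mult_left_mono) auto
    then show ?thesis
      using True i L by (simp add: inner_dyadic_corner abs_mult)
  next
    case False
    define y where "y = 2 ^ k * (x \<bullet> i) / L"
    have "(dyadic_corner L (Suc k) x - dyadic_corner L k x) \<bullet> i
        = L / 2 ^ Suc k * (of_int \<lfloor>2 * y\<rfloor> - 2 * of_int \<lfloor>y\<rfloor>)"
      using False i by (simp add: inner_diff_left inner_dyadic_corner y_def field_simps)
    then have "\<bar>(dyadic_corner L (Suc k) x - dyadic_corner L k x) \<bullet> i\<bar>
        = L / 2 ^ Suc k * \<bar>of_int \<lfloor>2 * y\<rfloor> - 2 * of_int \<lfloor>y\<rfloor>\<bar>"
      using L by (simp add: abs_mult)
    also have "\<dots> \<le> L / 2 ^ Suc k * 1"
      using L by (intro mult_left_mono floor_dyadic_diff) auto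
    also have "\<dots> \<le> L / 2 ^ k"
      using L by (simp add: field_simps)
    finally show ?thesis .
  qed
  then have "(\<Sum>i\<in>Basis. \<bar>(dyadic_corner L (Suc k) x - dyadic_corner L k x) \<bullet> i\<bar>) \<le> DIM('a) * (L / 2 ^ k)"
    by (intro sum_bounded_above) auto
  then show ?thesis
    using norm_le_l1[of "dyadic_corner L (Suc k) x - dyadic_corner L k x"] by simp
qed

lemma dyadic_corner_tendsto:
  fixes x :: "'a::euclidean_space"
  assumes L: "0 < L"
  shows "(\<lambda>k. dyadic_corner L k x) \<longlonglongrightarrow> x"
proof (rule tendsto_norm_zero_cancel[THEN LIM_zero_cancel])
  show "(\<lambda>k. norm (dyadic_corner L k x - x)) \<longlonglongrightarrow> 0"
  proof (rule tendsto_sandwich[where f="\<lambda>_. 0"])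
    have "norm (dyadic_corner L k x - x) \<le> DIM('a) * L * (1/2) ^ k" if k: "0 < k" for k
    proof -
      have "\<bar>(dyadic_corner L k x - x) \<bullet> i\<bar> \<le> L / 2 ^ k" if i: "i \<in> Basis" for i
      proof -
        define y where "y = 2 ^ k * (x \<bullet> i) / L"
        have "(dyadic_corner L k x - x) \<bullet> i = L / 2 ^ k * (of_int \<lfloor>y\<rfloor> - y)"
          using k i L by (simp add: inner_diff_left inner_dyadic_corner y_def field_simps)
        then have "\<bar>(dyadic_corner L k x - x) \<bullet> i\<bar> = L / 2 ^ k * \<bar>of_int \<lfloor>y\<rfloor> - y\<bar>"
          using L by (simp add: abs_mult)
        also have "\<dots> \<le> L / 2 ^ k * 1"
          using L by (intro mult_left_mono) (auto, linarith)
        finally show ?thesis by simp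
      qed
      then have "(\<Sum>i\<in>Basis. \<bar>(dyadic_corner L k x - x) \<bullet> i\<bar>) \<le> DIM('a) * (L / 2 ^ k)"
        by (intro sum_bounded_above) auto
      then show ?thesis
        using norm_le_l1[of "dyadic_corner L k x - x"] by (simp add: power_divide)
    qed
    then show "\<forall>\<^sub>F k in sequentially. norm (dyadic_corner L k x - x) \<le> DIM('a) * L * (1/2) ^ k"
      by (rule eventually_mono[OF eventually_gt_at_top[of "0::nat"]])
    have "(\<lambda>k. DIM('a) * L * (1/2) ^ k) \<longlonglongrightarrow> DIM('a) * L * 0"
      by (intro tendsto_intros LIMSEQ_power_zero) auto
    then show "(\<lambda>k. DIM('a) * L * (1/2) ^ k) \<longlonglongrightarrow> 0" by simp
  qed auto
qed

text \<open>At positive levels each coordinate of a corner is one of the \<open>2 * 2 ^ k\<close>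
  multiples of \<open>L / 2 ^ k\<close> in \<open>[-L, L)\<close>; level 0 has only the
  root.\<close>

lemma dyadic_corner_image:
  assumes L: "0 < L"
  shows "finite (dyadic_corner L k ` ball (0::'a::euclidean_space) L)"
    and "card (dyadic_corner L k ` ball (0::'a) L) \<le> (2 ^ Suc k) ^ DIM('a)"
proof -
  define F where "F = (\<lambda>f. \<Sum>i\<in>(Basis::'a set). (L * of_int (f i) / 2 ^ k) *\<^sub>R i)"
  define E where "E = (Basis::'a set) \<rightarrow>\<^sub>E {- (2 ^ k) ..< (2 ^ k :: int)}"
  have E: "finite E" "card E = (2 ^ Suc k) ^ DIM('a)"
    by (simp_all add: E_def finite_PiE card_PiE nat_mult_distrib nat_power_eq power_mult_distrib)
  have "dyadic_corner L k ` ball (0::'a) L \<subseteq> F ` E"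
  proof safe
    fix x :: 'a assume x: "x \<in> ball 0 L"
    show "dyadic_corner L k x \<in> F ` E"
    proof (cases "k = 0")
      case True
      have "dyadic_corner L k x = F (\<lambda>i\<in>Basis. 0)"
        using True by (simp add: F_def)
      then show ?thesis by (auto simp: E_def True)
    next
      case False
      have "dyadic_corner L k x = F (\<lambda>i\<in>Basis. \<lfloor>2 ^ k * (x \<bullet> i) / L\<rfloor>)"
        using False by (simp add: F_def dyadic_corner_def)
      moreover have "(\<lambda>i\<in>Basis. \<lfloor>2 ^ k * (x \<bullet> i) / L\<rfloor>) \<in> E"
        unfolding E_def
      proof (rule restrict_PiE_iff[THEN iffD2], rule ballI)
        fix i :: 'a assume i: "i \<in> Basis"
        have "\<bar>x \<bullet> i\<bar> < L"
          using Basis_le_norm[OF i, of x] x by simp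
        then have "-1 * 2 ^ k \<le> (x \<bullet> i) / L * 2 ^ k" "(x \<bullet> i) / L * 2 ^ k < 1 * 2 ^ k"
          using L by (intro mult_right_mono mult_strict_right_mono; simp add: field_simps; fail)+
        then show "\<lfloor>2 ^ k * (x \<bullet> i) / L\<rfloor> \<in> {- (2 ^ k) ..< 2 ^ k}"
          by (simp add: le_floor_iff floor_less_iff mult.commute)
      qed
      ultimately show ?thesis by blast
    qed
  qed
  then show "finite (dyadic_corner L k ` ball (0::'a) L)"
    "card (dyadic_corner L k ` ball (0::'a) L) \<le> (2 ^ Suc k) ^ DIM('a)"
    using E surj_card_le[of E _ F] by (auto intro: finite_surj)
qed

section \<open>Time parametrisation of the dyadic paths\<close>

definition dyadic_time :: "nat \<Rightarrow> real" where
  "dyadic_time k = 1 - (1/2) ^ k"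

lemma dyadic_time_simps [simp]: "dyadic_time 0 = 0" "0 \<le> dyadic_time k" "dyadic_time k < 1"
  "dyadic_time (Suc k) - dyadic_time k = 1 / 2 ^ Suc k"
  by (simp_all add: dyadic_time_def power_le_one power_divide field_simps)

lemma dyadic_time_mono: "j \<le> k \<Longrightarrow> dyadic_time j \<le> dyadic_time k"
  by (simp add: dyadic_time_def power_decreasing)

lemma dyadic_time_tendsto: "dyadic_time \<longlonglongrightarrow> 1"
proof -
  have "dyadic_time \<longlonglongrightarrow> 1 - 0"
    unfolding dyadic_time_def[abs_def] by (intro tendsto_intros LIMSEQ_power_zero) auto
  then show ?thesis by simp
qed

lemma ex_dyadic_time_interval:
  assumes "0 \<le> s" "s < 1"
  obtains k where "dyadic_time k \<le> s" "s < dyadic_time (Suc k)"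
proof -
  have "\<exists>k. s < dyadic_time k"
    using order_tendstoD(1)[OF dyadic_time_tendsto assms(2)] eventually_sequentially by auto
  then have *: "s < dyadic_time (LEAST k. s < dyadic_time k)"
    by (rule LeastI_ex)
  moreover have "(LEAST k. s < dyadic_time k) \<noteq> 0"
    using * assms(1) by (metis dyadic_time_simps(1) not_le)
  ultimately obtain k where k: "(LEAST k. s < dyadic_time k) = Suc k" "s < dyadic_time (Suc k)"
    by (metis not0_implies_Suc)
  then have "\<not> s < dyadic_time k"
    using not_less_Least[of k "\<lambda>k. s < dyadic_time k"] by simp
  with k show ?thesis by (intro that[of k]) auto
qed

text \<open>The factor is the reciprocal of the length of time slot \<open>k\<close>, so that slot
  covers exactly the edge from level \<open>k\<close> to level \<open>k + 1\<close>.\<close>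

definition dyadic_velocity :: "real \<Rightarrow> nat \<Rightarrow> 'a::euclidean_space \<Rightarrow> 'a" where
  "dyadic_velocity L k x = 2 ^ Suc k *\<^sub>R (dyadic_corner L (Suc k) x - dyadic_corner L k x)"

text \<open>Clipping \<open>s\<close> at both ends of the slot makes the sum over \<open>k\<close>
  telescope, to \<open>s\<close> itself when \<open>s\<close> is in [0, 1].\<close>

definition time_spent :: "nat \<Rightarrow> real \<Rightarrow> real" where
  "time_spent k s = min s (dyadic_time (Suc k)) - min s (dyadic_time k)"

text \<open>The path through \<open>dyadic_corner L k x\<close> at time \<open>dyadic_time k\<close>, written as the integral of its
  piecewise constant velocity. Steps shrink as fast as the time slots, so the speed stays bounded.\<close>

definition dyadic_path :: "real \<Rightarrow> 'a::euclidean_space \<Rightarrow> real \<Rightarrow> 'a" where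
  "dyadic_path L x s = (\<Sum>k. time_spent k s *\<^sub>R dyadic_velocity L k x)"

lemma norm_dyadic_velocity:
  fixes x :: "'a::euclidean_space"
  assumes "0 < L" "norm x < L"
  shows "norm (dyadic_velocity L k x) \<le> 2 * real DIM('a) * L"
proof -
  have "norm (dyadic_velocity L k x) \<le> 2 ^ Suc k * (real DIM('a) * L / 2 ^ k)"
    unfolding dyadic_velocity_def norm_scaleR
    using norm_dyadic_corner_Suc_diff[OF assms, of k] by (intro mult_mono) auto
  then show ?thesis by (simp add: field_simps)
qed

lemma time_spent_mono: "s \<le> t \<Longrightarrow> time_spent k s \<le> time_spent k t"
  using dyadic_time_mono[of k "Suc k"]
  by (auto simp: time_spent_def min_def simp del: dyadic_time_simps)

lemma time_spent_nonneg: "0 \<le> time_spent k s"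
  using dyadic_time_mono[of k "Suc k"] by (auto simp: time_spent_def min_def)

lemma time_spent_0 [simp]: "time_spent k 0 = 0"
  by (simp add: time_spent_def min_def)

lemma time_spent_sums:
  assumes "0 \<le> s" "s \<le> 1"
  shows "(\<lambda>k. time_spent k s) sums s"
proof -
  have "(\<lambda>k. min s (dyadic_time k)) \<longlonglongrightarrow> min s 1"
    by (intro tendsto_min tendsto_const dyadic_time_tendsto)
  from telescope_sums[OF this] show ?thesis
    using assms by (simp add: time_spent_def[abs_def] min_absorb1 min_absorb2)
qed

context
  fixes L :: real and x :: "'a::euclidean_space"
  assumes L: "0 < L" and x: "norm x < L"
begin

lemma summable_dyadic_path:
  assumes "0 \<le> s" "s \<le> 1"
  shows "summable (\<lambda>k. time_spent k s *\<^sub>R dyadic_velocity L k x)"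
proof (rule summable_comparison_test')
  show "summable (\<lambda>k. time_spent k s * (2 * real DIM('a) * L))"
    using time_spent_sums[OF assms] by (intro summable_mult2) (rule sums_summable)
  show "norm (time_spent k s *\<^sub>R dyadic_velocity L k x) \<le> time_spent k s * (2 * real DIM('a) * L)" for k
    using norm_dyadic_velocity[OF L x, of k] time_spent_nonneg[of k s] by (simp add: mult_left_mono)
qed

text \<open>The increments of \<open>time_spent\<close> are nonnegative and add up to
  \<open>t - s\<close>, and all velocities obey one bound. This includes time 1, where the slots
  accumulate.\<close>

lemma dyadic_path_lipschitz:
  assumes "0 \<le> s" "s \<le> t" "t \<le> 1"
  shows "norm (dyadic_path L x t - dyadic_path L x s) \<le> (2 * real DIM('a) * L) * (t - s)"
proof -
  let ?d = "\<lambda>k. time_spent k t - time_spent k s"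
  have sd: "?d sums (t - s)"
    using assms by (intro sums_diff time_spent_sums) auto
  have sm: "summable (\<lambda>k. time_spent k t *\<^sub>R dyadic_velocity L k x)"
    "summable (\<lambda>k. time_spent k s *\<^sub>R dyadic_velocity L k x)"
    using assms by (auto intro!: summable_dyadic_path)
  have "dyadic_path L x t - dyadic_path L x s = (\<Sum>k. ?d k *\<^sub>R dyadic_velocity L k x)"
    unfolding dyadic_path_def suminf_diff[OF sm] by (simp add: scaleR_left_diff_distrib)
  also have "norm \<dots> \<le> (\<Sum>k. ?d k * (2 * real DIM('a) * L))"
  proof (rule norm_suminf_le)
    show "norm (?d k *\<^sub>R dyadic_velocity L k x) \<le> ?d k * (2 * real DIM('a) * L)" for k
      using norm_dyadic_velocity[OF L x, of k] time_spent_mono[OF assms(2), of k]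
      by (simp add: mult_left_mono)
    show "summable (\<lambda>k. ?d k * (2 * real DIM('a) * L))"
      using sd by (intro summable_mult2) (rule sums_summable)
  qed
  also have "\<dots> = (t - s) * (2 * real DIM('a) * L)"
    using sums_mult2[OF sd] sums_unique by metis
  finally show ?thesis by (simp add: mult.commute)
qed

text \<open>The slots before \<open>k\<close> are used up, and their steps telescope from the root
  to \<open>dyadic_corner L k x\<close>; those after \<open>k\<close> have not begun.\<close>

lemma dyadic_path_affine:
  assumes "dyadic_time k \<le> s" "s \<le> dyadic_time (Suc k)"
  shows "dyadic_path L x s = dyadic_corner L k x + (s - dyadic_time k) *\<^sub>R dyadic_velocity L k x"
proof -
  have "time_spent j s = 0" if "j \<notin> {..k}" for j
  proof -
    have "s \<le> dyadic_time j" "s \<le> dyadic_time (Suc j)"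
      using that assms(2) dyadic_time_mono[of "Suc k" j] dyadic_time_mono[of "Suc k" "Suc j"] by auto
    then show ?thesis by (simp add: time_spent_def)
  qed
  then have "dyadic_path L x s = (\<Sum>j\<le>k. time_spent j s *\<^sub>R dyadic_velocity L j x)"
    unfolding dyadic_path_def by (intro suminf_finite) auto
  also have "\<dots> = (\<Sum>j<k. time_spent j s *\<^sub>R dyadic_velocity L j x) + time_spent k s *\<^sub>R dyadic_velocity L k x"
    by (simp add: lessThan_Suc_atMost[symmetric])
  also have "(\<Sum>j<k. time_spent j s *\<^sub>R dyadic_velocity L j x) =
      (\<Sum>j<k. dyadic_corner L (Suc j) x - dyadic_corner L j x)"
  proof (rule sum.cong)
    fix j assume "j \<in> {..<k}"
    then have "dyadic_time j \<le> s" "dyadic_time (Suc j) \<le> s"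
      using assms(1) dyadic_time_mono[of j k] dyadic_time_mono[of "Suc j" k] by auto
    then have "time_spent j s = 1 / 2 ^ Suc j"
      by (simp add: time_spent_def min_absorb2 del: power_Suc)
    then show "time_spent j s *\<^sub>R dyadic_velocity L j x = dyadic_corner L (Suc j) x - dyadic_corner L j x"
      by (simp add: dyadic_velocity_def)
  qed simp
  also have "\<dots> = dyadic_corner L k x"
    by (subst sum_lessThan_telescope) simp
  also have "time_spent k s = s - dyadic_time k"
    using assms by (simp add: time_spent_def min_def)
  finally show ?thesis .
qed

lemma dyadic_path_1: "dyadic_path L x 1 = x"
proof -
  have "time_spent k 1 = 1 / 2 ^ Suc k" for k
    using dyadic_time_simps(3)[of k] dyadic_time_simps(3)[of "Suc k"]
    by (simp add: time_spent_def min_absorb2 less_imp_le del: power_Suc dyadic_time_simps(3))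
  then have "time_spent k 1 *\<^sub>R dyadic_velocity L k x = dyadic_corner L (Suc k) x - dyadic_corner L k x" for k
    by (simp add: dyadic_velocity_def)
  then show ?thesis
    using sums_unique[OF telescope_sums[OF dyadic_corner_tendsto[OF L, of x]]]
    by (simp add: dyadic_path_def)
qed

end

lemma dyadic_path_0 [simp]: "dyadic_path L x 0 = 0"
  by (simp add: dyadic_path_def)

text \<open>In slot \<open>k\<close> the curve depends only on the corners of levels
  \<open>k\<close> and \<open>k + 1\<close>, and the latter determines the former.\<close>

lemma dyadic_path_cong:
  assumes "0 < L" "norm x < L" "norm y < L"
    and "dyadic_corner L (Suc k) x = dyadic_corner L (Suc k) y"
    and "dyadic_time k \<le> s" "s \<le> dyadic_time (Suc k)"
  shows "dyadic_path L x s = dyadic_path L y s"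
  using assms dyadic_corner_Suc_eqD[OF assms(1,4)]
  by (simp add: dyadic_path_affine dyadic_velocity_def)

text \<open>The series form of the path pays off here: joint measurability in end point and time is
  that of a countable sum.\<close>

lemma borel_measurable_dyadic_path [measurable (raw)]:
  assumes [measurable]: "f \<in> borel_measurable M" "g \<in> borel_measurable M"
  shows "(\<lambda>z. dyadic_path L (f z) (g z)) \<in> borel_measurable M"
  unfolding dyadic_path_def time_spent_def dyadic_velocity_def by measurable

section \<open>Concave costs\<close>

context
  fixes \<beta> :: "real \<Rightarrow> real"
  assumes concave: "concave_on {0..} \<beta>" and nonneg: "\<And>w. 0 \<le> w \<Longrightarrow> 0 \<le> \<beta> w"
begin

text \<open>\<open>w\<close> is a convex combination of 0 and \<open>v\<close>, and the contribution
  of \<open>\<beta> 0\<close> is nonnegative.\<close>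

lemma concave_nonneg_ratio_antimono:
  assumes "0 < w" "w \<le> v"
  shows "\<beta> v / v \<le> \<beta> w / w"
proof -
  have "(1 - w / v) * \<beta> 0 + w / v * \<beta> v \<le> \<beta> ((1 - w / v) *\<^sub>R 0 + (w / v) *\<^sub>R v)"
    using assms by (intro concave_onD[OF concave]) auto
  moreover have "0 \<le> (1 - w / v) * \<beta> 0"
    using assms nonneg[of 0] by (intro mult_nonneg_nonneg) auto
  ultimately have "w / v * \<beta> v \<le> \<beta> w"
    using assms by simp
  then show ?thesis
    using assms by (simp add: field_simps)
qed

text \<open>A concave function that decreases somewhere would become negative far enough to the
  right.\<close>

lemma concave_nonneg_mono:
  assumes "0 \<le> a" "a \<le> b"
  shows "\<beta> a \<le> \<beta> b"
proof (rule ccontr)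
  assume "\<not> \<beta> a \<le> \<beta> b"
  then have lt: "\<beta> b < \<beta> a" by simp
  have b0: "0 \<le> \<beta> b" using nonneg assms by auto
  \<comment> \<open>With this \<open>t\<close>, \<open>(1 - t) * \<beta> a\<close> is the midpoint
    of \<open>\<beta> a\<close> and \<open>\<beta> b\<close>, still above \<open>\<beta> b\<close>.
    The point \<open>c\<close> below is placed so that \<open>b\<close> is the convex combination of
    \<open>a\<close> and \<open>c\<close> with weight \<open>t\<close> on \<open>c\<close>.\<close>
  define t where "t = (\<beta> a - \<beta> b) / (2 * \<beta> a)"
  have t: "0 < t" "t \<le> 1" using lt b0 by (auto simp: t_def field_simps)
  define c where "c = a + (b - a) / t"
  have c: "0 \<le> c" using assms t by (simp add: c_def)
  have "(1 - t) *\<^sub>R a + t *\<^sub>R c = b"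
    using t by (simp add: c_def field_simps)
  moreover have "(1 - t) * \<beta> a + t * \<beta> c \<le> \<beta> ((1 - t) *\<^sub>R a + t *\<^sub>R c)"
    using assms c t by (intro concave_onD[OF concave]) auto
  moreover have "0 \<le> t * \<beta> c"
    using t nonneg[OF c] by simp
  ultimately have "(1 - t) * \<beta> a \<le> \<beta> b" by simp
  moreover have "(1 - t) * \<beta> a = (\<beta> a + \<beta> b) / 2"
    using lt b0 by (simp add: t_def field_simps)
  ultimately show False using lt by simp
qed

text \<open>Up to \<open>w\<close> monotonicity applies, beyond \<open>w\<close> the ratio bound.
  The result is affine in \<open>m\<close>, so a sum over cells needs only their number and their
  total mass.\<close>

lemma concave_nonneg_le:
  assumes "0 \<le> m" "0 < w"
  shows "\<beta> m \<le> (1 + m / w) * \<beta> w"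
proof (cases "m \<le> w")
  case True
  have "\<beta> m \<le> 1 * \<beta> w"
    using concave_nonneg_mono[OF assms(1) True] by simp
  also have "\<dots> \<le> (1 + m / w) * \<beta> w"
    using assms nonneg[of w] by (intro mult_right_mono) auto
  finally show ?thesis .
next
  case False
  then have "\<beta> m / m \<le> \<beta> w / w"
    using assms by (intro concave_nonneg_ratio_antimono) auto
  then have "\<beta> m \<le> m / w * \<beta> w"
    using False assms by (simp add: field_simps)
  also have "\<dots> \<le> (1 + m / w) * \<beta> w"
    using assms nonneg[of w] by (intro mult_right_mono) auto
  finally show ?thesis .
qed

text \<open>The sum is a lower Riemann sum of the admissibility integral over the blocks
  \<open>((1/2) ^ (n * (k + 1)), (1/2) ^ (n * k)]\<close>.\<close>

lemma dyadic_cost_sum_finite: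
  assumes n: "0 < n"
    and int: "(\<integral>\<^sup>+ w \<in> {0<..1}. ennreal (\<beta> w * w powr (- (2 - 1 / real n))) \<partial>lborel) < \<infinity>"
  shows "(\<Sum>k. ennreal ((1/2) ^ k * (\<beta> ((1/2) ^ (n * k)) / (1/2) ^ (n * k)))) < \<infinity>"
proof -
  define w where "w k = (1/2::real) ^ (n * k)" for k
  \<comment> \<open>This is the integrand at the right end of block \<open>k\<close>. Its factors
    \<open>\<beta> w / w\<close> and \<open>w powr (1 / n - 1)\<close> are both nonincreasing, so it
    bounds the integrand from below on the block.\<close>
  define c where "c k = \<beta> (w k) / w k * w k powr (1 / n - 1)" for k
  have w0: "0 < w k" for k by (simp add: w_def)
  have c0: "0 \<le> c k" for k
    using nonneg[of "w k"] w0[of k] by (simp add: c_def)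
  have anti: "w j \<le> w k" if "k \<le> j" for j k
    unfolding w_def using that by (intro power_decreasing) auto
  \<comment> \<open>Each block fills at least half of \<open>{0<..w k}\<close>; this is the factor
    1/2 in the sum below.\<close>
  have wS: "w (Suc k) \<le> w k / 2" for k
  proof -
    have "(1/2::real) ^ n \<le> (1/2) ^ 1"
      using n by (intro power_decreasing) auto
    then show ?thesis
      using w0[of k] by (simp add: w_def power_add)
  qed
  have "(\<Sum>k. ennreal ((1/2) ^ k * (\<beta> (w k) / w k) / 2))
      \<le> (\<Sum>k. \<integral>\<^sup>+ x. ennreal (c k) * indicator {w (Suc k)<..w k} x \<partial>lborel)"
  proof (intro suminf_le summableI)
    fix k
    have "w k = 2 powr (- (real n * k))"
      by (simp add: w_def powr_minus powr_realpow power_divide field_simps flip: of_nat_mult)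
    then have "w k powr (1 / n) = 2 powr (- real k)"
      using n by (simp add: powr_powr)
    then have wk: "w k powr (1 / n) = (1/2) ^ k"
      by (simp add: powr_minus powr_realpow power_divide field_simps)
    have "w k powr (1 / n - 1) = (1/2) ^ k / w k"
      using w0[of k] by (simp add: powr_diff wk)
    then have "(1/2) ^ k * (\<beta> (w k) / w k) / 2 = c k * (w k / 2)"
      using w0[of k] by (simp add: c_def)
    also have "\<dots> \<le> c k * (w k - w (Suc k))"
      using wS[of k] c0[of k] by (intro mult_left_mono) auto
    finally have "ennreal ((1/2) ^ k * (\<beta> (w k) / w k) / 2) \<le> ennreal (c k * (w k - w (Suc k)))"
      by (rule ennreal_leI)
    also have "\<dots> = (\<integral>\<^sup>+ x. ennreal (c k) * indicator {w (Suc k)<..w k} x \<partial>lborel)"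
      using anti[of k "Suc k"] c0[of k] by (simp add: nn_integral_cmult_indicator ennreal_mult)
    finally show "ennreal ((1/2) ^ k * (\<beta> (w k) / w k) / 2) \<le>
      (\<integral>\<^sup>+ x. ennreal (c k) * indicator {w (Suc k)<..w k} x \<partial>lborel)" .
  qed
  also have "\<dots> = (\<integral>\<^sup>+ x. (\<Sum>k. ennreal (c k) * indicator {w (Suc k)<..w k} x) \<partial>lborel)"
    by (rule nn_integral_suminf[symmetric]) auto
  also have "\<dots> \<le> (\<integral>\<^sup>+ w \<in> {0<..1}. ennreal (\<beta> w * w powr (- (2 - 1 / real n))) \<partial>lborel)"
  proof (rule nn_integral_mono)
    fix x :: real
    show "(\<Sum>k. ennreal (c k) * indicator {w (Suc k)<..w k} x)
      \<le> ennreal (\<beta> x * x powr (- (2 - 1 / real n))) * indicator {0<..1} x"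
    proof (cases "\<exists>k. x \<in> {w (Suc k)<..w k}")
      case False
      then have "(\<Sum>k. ennreal (c k) * indicator {w (Suc k)<..w k} x) = 0"
        by (intro suminf_eq_zero_iff[THEN iffD2]) (auto simp: indicator_def)
      then show ?thesis by simp
    next
      case True
      then obtain k where k: "x \<in> {w (Suc k)<..w k}" by blast
      have x0: "0 < x" using k w0[of "Suc k"] by auto
      have x1: "x \<le> 1" using k anti[of 0 k] by (auto simp: w_def)
      have "x \<notin> {w (Suc j)<..w j}" if "j \<noteq> k" for j
      proof (cases "j < k")
        case True
        then show ?thesis using k anti[of "Suc j" k] by auto
      next
        case False
        then show ?thesis using k anti[of "Suc k" j] that by auto
      qed
      then have "(\<Sum>k. ennreal (c k) * indicator {w (Suc k)<..w k} x)
          = (\<Sum>k\<in>{k}. ennreal (c k) * indicator {w (Suc k)<..w k} x)"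
        by (intro suminf_finite) auto
      also have "\<dots> = ennreal (c k)" using k by simp
      also have "\<dots> \<le> ennreal (\<beta> x * x powr (- (2 - 1 / real n)))"
      proof (rule ennreal_leI)
        have "c k \<le> \<beta> x / x * x powr (1 / n - 1)"
          unfolding c_def
        proof (rule mult_mono)
          show "\<beta> (w k) / w k \<le> \<beta> x / x"
            using k x0 by (intro concave_nonneg_ratio_antimono) auto
          show "w k powr (1 / n - 1) \<le> x powr (1 / n - 1)"
            using k x0 n by (intro powr_mono2') auto
          show "0 \<le> \<beta> x / x" using nonneg[of x] x0 by simp
        qed simp
        also have "x powr (1 / n - 1) = x * x powr (- (2 - 1 / real n))"
          using x0 powr_add[of x 1 "- (2 - 1 / real n)"] by (simp add: algebra_simps)
        finally show "c k \<le> \<beta> x * x powr (- (2 - 1 / real n))"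
          using x0 by simp
      qed
      finally show ?thesis using x0 x1 by simp
    qed
  qed
  also note int
  finally have fin: "(\<Sum>k. ennreal ((1/2) ^ k * (\<beta> (w k) / w k) / 2)) < \<infinity>" .
  have "(\<Sum>k. ennreal ((1/2) ^ k * (\<beta> (w k) / w k)))
      = (\<Sum>k. ennreal 2 * ennreal ((1/2) ^ k * (\<beta> (w k) / w k) / 2))"
    by (intro suminf_cong, subst ennreal_mult'[symmetric]) simp_all
  also have "\<dots> = ennreal 2 * (\<Sum>k. ennreal ((1/2) ^ k * (\<beta> (w k) / w k) / 2))"
    by (rule ennreal_suminf_cmult)
  also have "\<dots> < \<infinity>"
    using fin by (simp add: ennreal_mult_less_top)
  finally show ?thesis by (simp add: w_def)
qed

end

section \<open>Irrigation along dyadic trees\<close>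

lemma lipschitz_imp_abs_cont_01:
  assumes K: "0 < K"
    and lip: "\<And>s t. 0 \<le> s \<Longrightarrow> s \<le> t \<Longrightarrow> t \<le> 1 \<Longrightarrow> norm (f t - f s) \<le> K * (t - s)"
  shows "abs_cont_01 f"
  unfolding abs_cont_01_def
proof (intro allI impI)
  fix \<epsilon> :: real assume \<epsilon>: "0 < \<epsilon>"
  show "\<exists>\<delta>>0. \<forall>S. finite S \<and> S \<subseteq> {(a, b). 0 \<le> a \<and> a < b \<and> b \<le> 1} \<and>
         disjoint_family_on (\<lambda>(a, b). {a<..<b}) S \<and> (\<Sum>(a, b)\<in>S. b - a) < \<delta> \<longrightarrow>
         (\<Sum>(a, b)\<in>S. norm (f b - f a)) < \<epsilon>"
  proof (intro exI[of _ "\<epsilon> / K"] conjI allI impI; (elim conjE)?)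
    show "0 < \<epsilon> / K" using K \<epsilon> by simp
    fix S :: "(real \<times> real) set"
    assume S: "S \<subseteq> {(a, b). 0 \<le> a \<and> a < b \<and> b \<le> 1}" and len: "(\<Sum>(a, b)\<in>S. b - a) < \<epsilon> / K"
    have "(\<Sum>(a, b)\<in>S. norm (f b - f a)) \<le> (\<Sum>z\<in>S. K * (case z of (a, b) \<Rightarrow> b - a))"
      using S by (intro sum_mono) (auto intro!: lip)
    also have "\<dots> = K * (\<Sum>(a, b)\<in>S. b - a)"
      by (simp add: sum_distrib_left)
    also have "\<dots> < \<epsilon>"
      using len K by (simp add: field_simps)
    finally show "(\<Sum>(a, b)\<in>S. norm (f b - f a)) < \<epsilon>" .
  qed
qed

text \<open>The curve is compact, hence the closure of its values at countably many dense times, and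
  hitting \<open>x\<close> becomes a countable condition. This secures lower bounds on
  multiplicities, since \<open>measure\<close> is 0 on nonmeasurable sets.\<close>

lemma hitting_set_measurable:
  fixes \<gamma> :: "'g \<times> real \<Rightarrow> 'a::euclidean_space"
  assumes cont: "\<And>q. continuous_on {0..1} (\<lambda>t. \<gamma> (q, t))"
    and meas: "\<And>t. (\<lambda>q. \<gamma> (q, t)) \<in> borel_measurable P"
  shows "{q \<in> space P. x \<in> (\<lambda>t. \<gamma> (q, t)) ` {0..1}} \<in> sets P"
proof -
  obtain D :: "real set" where D: "countable D" "D \<subseteq> {0..1}" "{0..1} \<subseteq> closure D"
    using separable by blast
  have cl: "closure D = {0..1}"
    using D closure_minimal[OF D(2)] by auto
  have "x \<in> (\<lambda>t. \<gamma> (q, t)) ` {0..1} \<longleftrightarrow> (\<forall>n. \<exists>t\<in>D. dist (\<gamma> (q, t)) x < inverse (real (Suc n)))" for q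
  proof -
    let ?f = "\<lambda>t. \<gamma> (q, t)"
    have "closed (?f ` {0..1})"
      by (intro compact_imp_closed compact_continuous_image cont) simp
    then have "closure (?f ` D) \<subseteq> ?f ` {0..1}"
      using D(2) by (intro closure_minimal) auto
    moreover have "?f ` closure D \<subseteq> closure (?f ` D)"
      using cont[of q] by (intro image_closure_subset) (auto simp: cl closure_subset)
    ultimately have "?f ` {0..1} = closure (?f ` D)"
      by (simp add: cl)
    moreover have "x \<in> closure (?f ` D) \<longleftrightarrow> (\<forall>n. \<exists>t\<in>D. dist (?f t) x < inverse (real (Suc n)))"
    proof
      assume "x \<in> closure (?f ` D)"
      then show "\<forall>n. \<exists>t\<in>D. dist (?f t) x < inverse (real (Suc n))"
        by (auto simp: closure_approachable)
    next
      assume *: "\<forall>n. \<exists>t\<in>D. dist (?f t) x < inverse (real (Suc n))"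
      show "x \<in> closure (?f ` D)"
        unfolding closure_approachable
      proof (intro allI impI)
        fix e :: real assume "0 < e"
        then obtain n where "inverse (real (Suc n)) < e"
          using reals_Archimedean by blast
        moreover obtain t where "t \<in> D" "dist (?f t) x < inverse (real (Suc n))"
          using * by blast
        ultimately show "\<exists>y\<in>?f ` D. dist y x < e"
          by (intro bexI[of _ "?f t"]) auto
      qed
    qed
    ultimately show ?thesis by simp
  qed
  moreover have "{q \<in> space P. \<forall>n. \<exists>t\<in>D. dist (\<gamma> (q, t)) x < inverse (real (Suc n))} \<in> sets P"
  proof -
    have [measurable]: "(\<lambda>q. \<gamma> (q, t)) \<in> borel_measurable P" for t by (rule meas)
    note [measurable] = D(1)
    show ?thesis by measurable
  qed
  ultimately show ?thesis by simp
qed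

section \<open>Cost of a single tree\<close>

definition cell_mass :: "'g measure \<Rightarrow> real \<Rightarrow> ('g \<Rightarrow> 'a::euclidean_space) \<Rightarrow> nat \<Rightarrow> 'g \<Rightarrow> real" where
  "cell_mass P L T k p = measure P {q \<in> space P. dyadic_corner L k (T q) = dyadic_corner L k (T p)}"

text \<open>The value at \<open>m = 0\<close> makes the pointwise bound on the cost integrand hold for every particle;
  it does not contribute to the integral because particles in null cells form a null set.\<close>

definition cost_density :: "(real \<Rightarrow> real) \<Rightarrow> real \<Rightarrow> ennreal" where
  "cost_density \<beta> m = (if m = 0 then top else ennreal (\<beta> m / m))"

text \<open>This models one of the two trees; the final proof instantiates it with both transport
  maps.\<close>

locale dyadic_irrigation = finite_measure P for P :: "'g measure" +
  fixes \<beta> :: "real \<Rightarrow> real" and L :: real and T :: "'g \<Rightarrow> 'a::euclidean_space"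
  assumes concave: "concave_on {0..} \<beta>" and nonneg: "\<And>w. 0 \<le> w \<Longrightarrow> 0 \<le> \<beta> w"
    and L: "0 < L" and T [measurable]: "T \<in> borel_measurable P" and T_less: "\<And>p. norm (T p) < L"
begin

text \<open>A cell of mass \<open>m\<close> contributes \<open>\<beta> m\<close> to the integral. In
  the affine bound of \<open>concave_nonneg_le\<close> with
  \<open>w = (1/2) ^ (DIM('a) * k)\<close>, the constant part is summed over at most
  \<open>2 ^ DIM('a) / w\<close> cells, and the linear part adds up to the total mass because the
  cells are disjoint.\<close>

lemma
  shows borel_measurable_cell_cost [measurable]:
      "(\<lambda>p. cost_density \<beta> (cell_mass P L T k p)) \<in> borel_measurable P"
    and cell_cost_le: "(\<integral>\<^sup>+ p. cost_density \<beta> (cell_mass P L T k p) \<partial>P)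
      \<le> ennreal ((2 ^ DIM('a) + measure P (space P)) * (\<beta> ((1/2) ^ (DIM('a) * k)) / (1/2) ^ (DIM('a) * k)))"
proof -
  define V where "V = dyadic_corner L k ` ball (0::'a) L"
  define F where "F v = {q \<in> space P. dyadic_corner L k (T q) = v}" for v
  define w where "w = (1/2::real) ^ (DIM('a) * k)"
  have w0: "0 < w" by (simp add: w_def)
  have V: "finite V" "real (card V) \<le> 2 ^ DIM('a) / w"
  proof -
    show "finite V" unfolding V_def by (rule dyadic_corner_image[OF L])
    have "real (card V) \<le> real ((2 ^ Suc k) ^ DIM('a))"
      unfolding V_def by (intro of_nat_mono dyadic_corner_image[OF L])
    also have "\<dots> = 2 ^ DIM('a) / w"
      by (simp add: w_def power_mult_distrib power_divide mult.commute flip: power_mult)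
    finally show "real (card V) \<le> 2 ^ DIM('a) / w" .
  qed
  have F [measurable]: "F v \<in> sets P" for v unfolding F_def by measurable
  have inV: "dyadic_corner L k (T p) \<in> V" for p
    using T_less[of p] by (auto simp: V_def)
  have rep: "cost_density \<beta> (cell_mass P L T k p)
      = (\<Sum>v\<in>V. cost_density \<beta> (measure P (F v)) * indicator (F v) p)" if "p \<in> space P" for p
  proof -
    have "(\<Sum>v\<in>V. cost_density \<beta> (measure P (F v)) * indicator (F v) p)
        = (\<Sum>v\<in>V. if v = dyadic_corner L k (T p) then cost_density \<beta> (measure P (F v)) else 0)"
      using that by (intro sum.cong) (auto simp: F_def)
    also have "\<dots> = cost_density \<beta> (cell_mass P L T k p)"
      using inV[of p] V(1) by (simp add: F_def cell_mass_def)
    finally show ?thesis by simp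
  qed
  show "(\<lambda>p. cost_density \<beta> (cell_mass P L T k p)) \<in> borel_measurable P"
    by (subst measurable_cong[OF rep]) (assumption, measurable)
  have "(\<integral>\<^sup>+ p. cost_density \<beta> (cell_mass P L T k p) \<partial>P)
      = (\<integral>\<^sup>+ p. (\<Sum>v\<in>V. cost_density \<beta> (measure P (F v)) * indicator (F v) p) \<partial>P)"
    by (intro nn_integral_cong rep)
  also have "\<dots> = (\<Sum>v\<in>V. cost_density \<beta> (measure P (F v)) * emeasure P (F v))"
    by (subst nn_integral_sum) (auto simp: nn_integral_cmult_indicator)
  also have "\<dots> \<le> (\<Sum>v\<in>V. ennreal (\<beta> w + measure P (F v) * (\<beta> w / w)))"
  proof (rule sum_mono)
    fix v
    have "\<beta> (measure P (F v)) \<le> (1 + measure P (F v) / w) * \<beta> w"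
      using w0 by (intro concave_nonneg_le[OF concave nonneg]) auto
    then have "\<beta> (measure P (F v)) \<le> \<beta> w + measure P (F v) * (\<beta> w / w)"
      by (simp add: algebra_simps)
    \<comment> \<open>For a null cell the left side is \<open>top * 0 = 0\<close>.\<close>
    then show "cost_density \<beta> (measure P (F v)) * emeasure P (F v)
        \<le> ennreal (\<beta> w + measure P (F v) * (\<beta> w / w))"
      using nonneg[of "measure P (F v)"]
      by (auto simp: cost_density_def emeasure_eq_measure simp flip: ennreal_mult intro!: ennreal_leI)
  qed
  also have "\<dots> = ennreal (\<Sum>v\<in>V. \<beta> w + measure P (F v) * (\<beta> w / w))"
    using nonneg[of w] w0 by (intro sum_ennreal) auto
  also have "\<dots> \<le> ennreal ((2 ^ DIM('a) + measure P (space P)) * (\<beta> w / w))"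
  proof (rule ennreal_leI)
    have "(\<Sum>v\<in>V. measure P (F v)) = measure P (\<Union>v\<in>V. F v)"
      using V(1) by (intro finite_measure_finite_Union[symmetric]) (auto simp: disjoint_family_on_def F_def)
    also have "\<dots> \<le> measure P (space P)"
      by (rule bounded_measure)
    finally have "(\<Sum>v\<in>V. measure P (F v)) * (\<beta> w / w) \<le> measure P (space P) * (\<beta> w / w)"
      using nonneg[of w] w0 by (intro mult_right_mono) auto
    moreover have "real (card V) * \<beta> w \<le> 2 ^ DIM('a) / w * \<beta> w"
      using nonneg[of w] w0 V(2) by (intro mult_right_mono) auto
    ultimately show "(\<Sum>v\<in>V. \<beta> w + measure P (F v) * (\<beta> w / w))
        \<le> (2 ^ DIM('a) + measure P (space P)) * (\<beta> w / w)"
      unfolding sum.distrib sum_constant by (simp only: sum_distrib_right distrib_right) simp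
  qed
  finally show "(\<integral>\<^sup>+ p. cost_density \<beta> (cell_mass P L T k p) \<partial>P)
      \<le> ennreal ((2 ^ DIM('a) + measure P (space P)) * (\<beta> ((1/2) ^ (DIM('a) * k)) / (1/2) ^ (DIM('a) * k)))"
    by (simp add: w_def)
qed

text \<open>The weight \<open>(1/2) ^ Suc k\<close> is the length of time slot \<open>k\<close>; at
  bounded speed it stands for the length of the edge into level \<open>k + 1\<close>.\<close>

lemma tree_cost_finite:
  assumes int: "(\<integral>\<^sup>+ w \<in> {0<..1}. ennreal (\<beta> w * w powr (- (2 - 1 / real DIM('a)))) \<partial>lborel) < \<infinity>"
  shows "(\<Sum>k. ennreal ((1/2) ^ Suc k) * (\<integral>\<^sup>+ p. cost_density \<beta> (cell_mass P L T (Suc k) p) \<partial>P)) < \<infinity>"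
proof -
  let ?C = "2 ^ DIM('a) + measure P (space P)"
  let ?w = "\<lambda>k. (1/2::real) ^ (DIM('a) * k)"
  let ?f = "\<lambda>k. ennreal ((1/2) ^ k * (\<beta> (?w k) / ?w k))"
  have C: "0 \<le> ?C" by simp
  have "(\<Sum>k. ennreal ((1/2) ^ Suc k) * (\<integral>\<^sup>+ p. cost_density \<beta> (cell_mass P L T (Suc k) p) \<partial>P))
      \<le> (\<Sum>k. ennreal ?C * ?f (Suc k))"
  proof (intro suminf_le summableI)
    fix k
    have "ennreal ((1/2) ^ Suc k) * (\<integral>\<^sup>+ p. cost_density \<beta> (cell_mass P L T (Suc k) p) \<partial>P)
        \<le> ennreal ((1/2) ^ Suc k) * ennreal (?C * (\<beta> (?w (Suc k)) / ?w (Suc k)))"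
      by (intro mult_left_mono cell_cost_le) simp
    also have "\<dots> = ennreal ((1/2) ^ Suc k * (?C * (\<beta> (?w (Suc k)) / ?w (Suc k))))"
      by (rule ennreal_mult'[symmetric]) simp
    also have "\<dots> = ennreal (?C * ((1/2) ^ Suc k * (\<beta> (?w (Suc k)) / ?w (Suc k))))"
      by (rule arg_cong[where f=ennreal]) (simp only: mult.left_commute)
    also have "\<dots> = ennreal ?C * ?f (Suc k)"
      by (rule ennreal_mult'[OF C])
    finally show "ennreal ((1/2) ^ Suc k) * (\<integral>\<^sup>+ p. cost_density \<beta> (cell_mass P L T (Suc k) p) \<partial>P)
        \<le> ennreal ?C * ?f (Suc k)" .
  qed
  also have "\<dots> = ennreal ?C * (\<Sum>k. ?f (Suc k))"
    by (rule ennreal_suminf_cmult)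
  also have "\<dots> \<le> ennreal ?C * (\<Sum>k. ?f k)"
    using suminf_offset[OF summableI, of ?f 1] by (intro mult_left_mono) simp_all
  also have "\<dots> < \<infinity>"
    using dyadic_cost_sum_finite[OF concave nonneg _ int] by (simp add: ennreal_mult_less_top)
  finally show ?thesis .
qed

text \<open>By Tonelli, integrating over time first turns \<open>I k\<close> into the weight of
  level \<open>k + 1\<close>. General sets \<open>I k\<close> serve the descending and the ascending
  half alike.\<close>

lemma tree_integral_finite:
  assumes int: "(\<integral>\<^sup>+ w \<in> {0<..1}. ennreal (\<beta> w * w powr (- (2 - 1 / real DIM('a)))) \<partial>lborel) < \<infinity>"
    and U: "finite_measure U" and I [measurable]: "\<And>k. I k \<in> sets U"
    and I_le: "\<And>k. emeasure U (I k) \<le> ennreal ((1/2) ^ Suc k)"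
  shows "(\<integral>\<^sup>+ (p, t). (\<Sum>k. cost_density \<beta> (cell_mass P L T (Suc k) p) * indicator (I k) t) \<partial>(P \<Otimes>\<^sub>M U)) < \<infinity>"
proof -
  interpret U: finite_measure U by fact
  have "(\<integral>\<^sup>+ (p, t). (\<Sum>k. cost_density \<beta> (cell_mass P L T (Suc k) p) * indicator (I k) t) \<partial>(P \<Otimes>\<^sub>M U))
      = (\<integral>\<^sup>+ p. \<integral>\<^sup>+ t. (\<Sum>k. cost_density \<beta> (cell_mass P L T (Suc k) p) * indicator (I k) t) \<partial>U \<partial>P)"
    by (subst U.nn_integral_fst[symmetric]) simp_all
  also have "\<dots> = (\<integral>\<^sup>+ p. (\<Sum>k. cost_density \<beta> (cell_mass P L T (Suc k) p) * emeasure U (I k)) \<partial>P)"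
    by (intro nn_integral_cong, subst nn_integral_suminf) (simp_all add: nn_integral_cmult_indicator)
  also have "\<dots> = (\<Sum>k. (\<integral>\<^sup>+ p. cost_density \<beta> (cell_mass P L T (Suc k) p) \<partial>P) * emeasure U (I k))"
    by (subst nn_integral_suminf) (simp_all add: nn_integral_multc)
  also have "\<dots> \<le> (\<Sum>k. ennreal ((1/2) ^ Suc k) * (\<integral>\<^sup>+ p. cost_density \<beta> (cell_mass P L T (Suc k) p) \<partial>P))"
    by (subst mult.commute) (intro suminf_le summableI mult_right_mono I_le, simp)
  also have "\<dots> < \<infinity>"
    by (rule tree_cost_finite[OF int])
  finally show ?thesis .
qed

text \<open>All particles of the level \<open>k + 1\<close> cell of \<open>T p\<close> are at the same point at the same time,
  which bounds the multiplicity from below.\<close>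

lemma cost_integrand_le:
  fixes \<gamma> :: "'g \<times> real \<Rightarrow> 'a"
  assumes \<tau>: "\<And>w. 0 \<le> w \<Longrightarrow> \<tau> w \<le> \<beta> w"
    and hit: "\<And>x. {q \<in> space P. x \<in> (\<lambda>t. \<gamma> (q, t)) ` {0..1}} \<in> sets P"
    and S: "open S" "S \<subseteq> {0..1}" "t \<in> S"
    and path: "\<And>q s. s \<in> S \<Longrightarrow> \<gamma> (q, s) = dyadic_path L (T q) (b + c * s)"
    and t: "dyadic_time k < b + c * t" "b + c * t < dyadic_time (Suc k)"
    and c: "\<bar>c\<bar> = 2" and p: "p \<in> space P"
  shows "r_tau \<tau> (multiplicity_pat P \<gamma> (\<gamma> (p, t))) *
      ennreal (norm (vector_derivative (\<lambda>s. \<gamma> (p, s)) (at t within {0..1})))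
    \<le> ennreal (4 * real DIM('a) * L) * cost_density \<beta> (cell_mass P L T (Suc k) p)"
proof (cases "cell_mass P L T (Suc k) p = 0")
  case True
  then show ?thesis
    using L by (simp add: cost_density_def ennreal_mult_top)
next
  case False
  define m where "m = cell_mass P L T (Suc k) p"
  define w where "w = multiplicity_pat P \<gamma> (\<gamma> (p, t))"
  have m0: "0 < m"
    using False by (simp add: m_def cell_mass_def zero_less_measure_iff)
  have "m \<le> w"
    unfolding m_def w_def cell_mass_def multiplicity_pat_def
  proof (rule finite_measure_mono[OF _ hit], safe)
    fix q assume "q \<in> space P" "dyadic_corner L (Suc k) (T q) = dyadic_corner L (Suc k) (T p)"
    then have "\<gamma> (q, t) = \<gamma> (p, t)"
      using t S L T_less by (auto simp: path intro!: dyadic_path_cong[where k=k])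
    then show "\<gamma> (p, t) \<in> (\<lambda>t. \<gamma> (q, t)) ` {0..1}"
      using S by (metis image_eqI subsetD)
  qed
  \<comment> \<open>The chain is
    \<open>\<tau> w / w \<le> \<beta> w / w \<le> \<beta> m / m\<close>, the second step by
    concavity.\<close>
  then have "\<tau> w / w \<le> \<beta> m / m"
    using concave_nonneg_ratio_antimono[OF concave nonneg m0, of w] \<tau>[of w] m0
    by (meson divide_right_mono less_imp_le order_trans)
  then have r: "r_tau \<tau> w \<le> cost_density \<beta> m"
    using m0 \<open>m \<le> w\<close> by (auto simp: r_tau_def cost_density_def intro!: ennreal_leI)
  define v where "v = dyadic_velocity L k (T p)"
  \<comment> \<open>On this open neighbourhood of \<open>t\<close> the curve is affine, so its
    derivative at \<open>t\<close> can be read off.\<close>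
  define U where "U = S \<inter> {s. dyadic_time k < b + c * s \<and> b + c * s < dyadic_time (Suc k)}"
  have "open U"
    unfolding U_def by (intro open_Int S open_Collect_conj open_Collect_less continuous_intros)
  have "((\<lambda>s. dyadic_corner L k (T p) + (b + c * s - dyadic_time k) *\<^sub>R v) has_vector_derivative c *\<^sub>R v) (at t)"
    by (auto intro!: derivative_eq_intros simp: has_vector_derivative_def)
  then have "((\<lambda>s. \<gamma> (p, s)) has_vector_derivative c *\<^sub>R v) (at t)"
  proof (rule has_vector_derivative_transform_within_open[OF _ \<open>open U\<close>])
    show "t \<in> U" using S t by (simp add: U_def)
    show "dyadic_corner L k (T p) + (b + c * s - dyadic_time k) *\<^sub>R v = \<gamma> (p, s)" if "s \<in> U" for s
      using that dyadic_path_affine[OF L T_less, of k "b + c * s" p] by (simp add: U_def path v_def)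
  qed
  then have "((\<lambda>s. \<gamma> (p, s)) has_vector_derivative c *\<^sub>R v) (at t within {0..1})"
    by (rule has_vector_derivative_at_within)
  then have "vector_derivative (\<lambda>s. \<gamma> (p, s)) (at t within {0..1}) = c *\<^sub>R v"
    using S by (intro vector_derivative_within_closed_interval) auto
  \<comment> \<open>Each tree is traversed in half of the unit interval, so
    \<open>\<bar>c\<bar> = 2\<close> doubles the bound of
    \<open>norm_dyadic_velocity\<close>.\<close>
  then have "norm (vector_derivative (\<lambda>s. \<gamma> (p, s)) (at t within {0..1})) \<le> 4 * real DIM('a) * L"
    using norm_dyadic_velocity[OF L T_less[of p], of k] c by (simp add: v_def mult_ac)
  then show ?thesis
    using r unfolding w_def m_def
    by (subst mult.commute) (intro mult_mono ennreal_leI, auto)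
qed

end

section \<open>Joining the two trees at the root\<close>

theorem mainTheorem11:
  fixes \<tau> :: "real \<Rightarrow> real"
    and \<mu>p \<mu>m :: "'a::euclidean_space measure"
    and P :: "'g::{polish_space,metric_space} measure"
  assumes "admissible_cost DIM('a) \<tau>"
    and "sets \<mu>p = sets borel" and "sets \<mu>m = sets borel"
    and "emeasure \<mu>p UNIV < \<infinity>"
    and "emeasure \<mu>p UNIV = emeasure \<mu>m UNIV"
    and "bounded_support \<mu>p" and "bounded_support \<mu>m"
    and "reference_space P"
    and "emeasure P UNIV = emeasure \<mu>p UNIV"
  shows "\<exists>\<gamma> :: 'g \<times> real \<Rightarrow> 'a. irrigation_pattern P \<gamma> \<and> J_tau_bd \<tau> \<mu>p \<mu>m P \<gamma> < \<infinity>"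
proof -
  obtain \<beta> where \<beta>: "concave_on {0..} \<beta>" "\<And>w. 0 \<le> w \<Longrightarrow> 0 \<le> \<beta> w" "\<And>w. 0 \<le> w \<Longrightarrow> \<tau> w \<le> \<beta> w"
    and int: "(\<integral>\<^sup>+ w \<in> {0<..1}. ennreal (\<beta> w * w powr (- (2 - 1 / real DIM('a)))) \<partial>lborel) < \<infinity>"
    using assms(1) unfolding admissible_cost_def by blast
  obtain Rp Rm where R: "emeasure \<mu>p (UNIV - cball 0 Rp) = 0" "emeasure \<mu>m (UNIV - cball 0 Rm) = 0"
    using assms(6,7) unfolding bounded_support_def by blast
  have P: "sets P = sets borel" "\<And>x. emeasure P {x} = 0" "0 < emeasure P UNIV" "emeasure P UNIV < \<infinity>"
    using assms(8) unfolding reference_space_def by auto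
  have spP: "space P = UNIV"
    using sets_eq_imp_space_eq[OF P(1)] by simp
  have massm: "emeasure P UNIV = emeasure \<mu>m UNIV"
    using assms(5,9) by simp
  obtain Tp where Tp0: "Tp \<in> borel_measurable borel" and Tp: "distr P borel Tp = \<mu>p"
    and Tp_R: "\<And>p. Tp p \<in> cball 0 \<bar>Rp\<bar>"
    using ex_transport_map[OF P(1,2) assms(9) P(3,4) assms(2) R(1)] by blast
  obtain Tm where Tm0: "Tm \<in> borel_measurable borel" and Tm: "distr P borel Tm = \<mu>m"
    and Tm_R: "\<And>p. Tm p \<in> cball 0 \<bar>Rm\<bar>"
    using ex_transport_map[OF P(1,2) massm P(3,4) assms(3) R(2)] by blast
  define L where "L = max \<bar>Rp\<bar> \<bar>Rm\<bar> + 1"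
  have L: "0 < L" unfolding L_def by linarith
  have Tp_less: "norm (Tp p) < L" and Tm_less: "norm (Tm p) < L" for p
    using Tp_R[of p] Tm_R[of p] by (auto simp: L_def)
  have Tp_P [measurable]: "Tp \<in> borel_measurable P" and Tm_P [measurable]: "Tm \<in> borel_measurable P"
    using Tp0 Tm0 P(1) by (simp_all cong: measurable_cong_sets)
  interpret finite_measure P
    using P(4) by (intro finite_measureI) (simp add: spP)
  interpret plus: dyadic_irrigation P \<beta> L Tp
    using \<beta> L Tp_P Tp_less by unfold_locales auto
  interpret minus: dyadic_irrigation P \<beta> L Tm
    using \<beta> L Tm_P Tm_less by unfold_locales auto
  \<comment> \<open>The path to \<open>Tp p\<close> is run backwards until time 1/2, then the path
    to \<open>Tm p\<close> forwards. The clipping with \<open>max 0\<close> parks the idle summand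
    at the root 0, so a sum replaces a case distinction and stays visibly measurable and
    Lipschitz.\<close>
  define \<gamma> where "\<gamma> = (\<lambda>(p, t). dyadic_path L (Tp p) (max 0 (1 - 2 * t)) + dyadic_path L (Tm p) (max 0 (2 * t - 1)))"
  define K where "K = 2 * real DIM('a) * L"
  have K: "0 < K" using L by (simp add: K_def)

  have lip: "norm (\<gamma> (p, t) - \<gamma> (p, s)) \<le> 4 * K * (t - s)" if st: "0 \<le> s" "s \<le> t" "t \<le> 1" for p s t
  proof -
    let ?a = "\<lambda>t. max 0 (1 - 2 * t)" and ?b = "\<lambda>t. max 0 (2 * t - 1)"
    have "norm (dyadic_path L (Tp p) (?a s) - dyadic_path L (Tp p) (?a t)) \<le> K * (?a s - ?a t)"
      unfolding K_def using st by (intro dyadic_path_lipschitz L Tp_less) auto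
    also have "\<dots> \<le> K * (2 * (t - s))"
      using st K by (intro mult_left_mono) auto
    finally have 1: "norm (dyadic_path L (Tp p) (?a t) - dyadic_path L (Tp p) (?a s)) \<le> K * (2 * (t - s))"
      by (simp add: norm_minus_commute)
    have "norm (dyadic_path L (Tm p) (?b t) - dyadic_path L (Tm p) (?b s)) \<le> K * (?b t - ?b s)"
      unfolding K_def using st by (intro dyadic_path_lipschitz L Tm_less) auto
    also have "\<dots> \<le> K * (2 * (t - s))"
      using st K by (intro mult_left_mono) auto
    finally have 2: "norm (dyadic_path L (Tm p) (?b t) - dyadic_path L (Tm p) (?b s)) \<le> K * (2 * (t - s))" .
    have "\<gamma> (p, t) - \<gamma> (p, s) = (dyadic_path L (Tp p) (?a t) - dyadic_path L (Tp p) (?a s))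
        + (dyadic_path L (Tm p) (?b t) - dyadic_path L (Tm p) (?b s))"
      by (simp add: \<gamma>_def)
    then have "norm (\<gamma> (p, t) - \<gamma> (p, s)) \<le> K * (2 * (t - s)) + K * (2 * (t - s))"
      using norm_triangle_le[OF add_mono[OF 1 2]] by (simp only:)
    then show ?thesis by (simp add: algebra_simps)
  qed

  have cont: "continuous_on {0..1} (\<lambda>t. \<gamma> (p, t))" for p
  proof (rule lipschitz_on_continuous_on[where L="4 * K"], rule lipschitz_onI)
    fix s t :: real assume "s \<in> {0..1}" "t \<in> {0..1}"
    then show "dist (\<gamma> (p, s)) (\<gamma> (p, t)) \<le> 4 * K * dist s t"
      using lip[of s t p] lip[of t s p]
      by (cases "s \<le> t") (auto simp: dist_norm norm_minus_commute)
  qed (use K in simp)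
  have hit: "{q \<in> space P. x \<in> (\<lambda>t. \<gamma> (q, t)) ` {0..1}} \<in> sets P" for x
    by (rule hitting_set_measurable[OF cont]) (simp add: \<gamma>_def)

  let ?U = unit_interval_measure
  interpret U: finite_measure ?U
    by (intro finite_measureI) (simp add: space_restrict_space emeasure_restrict_space)
  have snd_meas [measurable]: "snd \<in> borel_measurable (P \<Otimes>\<^sub>M ?U)"
    by (rule measurable_compose[OF measurable_snd]) (simp add: measurable_restrict_space1)
  have "irrigation_pattern P \<gamma>"
    unfolding irrigation_pattern_def
  proof (intro conjI AE_I2)
    show "\<gamma> \<in> borel_measurable (P \<Otimes>\<^sub>M ?U)"
      unfolding \<gamma>_def split_beta' by measurable
    show "abs_cont_01 (\<lambda>t. \<gamma> (p, t))" for p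
      using K lip by (intro lipschitz_imp_abs_cont_01[where K="4 * K"]) auto
  qed

  moreover have "mu_plus P \<gamma> = \<mu>p"
    using Tp by (simp add: mu_plus_def \<gamma>_def dyadic_path_1[OF L Tp_less])
  moreover have "mu_minus P \<gamma> = \<mu>m"
    using Tm by (simp add: mu_minus_def \<gamma>_def dyadic_path_1[OF L Tm_less])

  moreover have "J_tau \<tau> P \<gamma> < \<infinity>"
  proof -
    \<comment> \<open>\<open>Ip k\<close> and \<open>Im k\<close> are the interiors of slot
      \<open>k\<close> pulled back along \<open>1 - 2 * t\<close> and
      \<open>2 * t - 1\<close>.\<close>
    define Ip where "Ip k = {(1 - dyadic_time (Suc k)) / 2 <..< (1 - dyadic_time k) / 2}" for k
    define Im where "Im k = {(1 + dyadic_time k) / 2 <..< (1 + dyadic_time (Suc k)) / 2}" for k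
    \<comment> \<open>The break points of the paths, where the velocity may be undefined.\<close>
    define N where "N = {0, 1} \<union> range (\<lambda>k. (1 - dyadic_time k) / 2) \<union> range (\<lambda>k. (1 + dyadic_time k) / 2)"
    have sub: "Ip k \<subseteq> {0..1}" "Im k \<subseteq> {0..1}" for k
      using dyadic_time_simps(2,3)[of k] dyadic_time_simps(2,3)[of "Suc k"]
      by (auto simp: Ip_def Im_def simp del: dyadic_time_simps)
    have len: "emeasure ?U (Ip k) \<le> ennreal ((1/2) ^ Suc k)" "emeasure ?U (Im k) \<le> ennreal ((1/2) ^ Suc k)" for k
    proof -
      have d: "(1 - dyadic_time k) / 2 - (1 - dyadic_time (Suc k)) / 2 = (1/2) ^ Suc k / 2"
        "(1 + dyadic_time (Suc k)) / 2 - (1 + dyadic_time k) / 2 = (1/2) ^ Suc k / 2"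
        by (simp_all add: dyadic_time_def diff_divide_distrib add_divide_distrib)
      have "emeasure ?U (Ip k) = emeasure lborel (Ip k)" "emeasure ?U (Im k) = emeasure lborel (Im k)"
        using sub[of k] by (auto intro!: emeasure_restrict_space)
      moreover have "emeasure lborel (Ip k) = ennreal ((1/2) ^ Suc k / 2)"
        unfolding Ip_def d(1)[symmetric] using dyadic_time_mono[of k "Suc k"]
        by (intro emeasure_lborel_Ioo) auto
      moreover have "emeasure lborel (Im k) = ennreal ((1/2) ^ Suc k / 2)"
        unfolding Im_def d(2)[symmetric] using dyadic_time_mono[of k "Suc k"]
        by (intro emeasure_lborel_Ioo) auto
      ultimately show "emeasure ?U (Ip k) \<le> ennreal ((1/2) ^ Suc k)" "emeasure ?U (Im k) \<le> ennreal ((1/2) ^ Suc k)"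
        by (auto intro!: ennreal_leI)
    qed
    have meas [measurable]: "Ip k \<in> sets ?U" "Im k \<in> sets ?U" for k
      using sub[of k] by (auto simp: sets_restrict_space_iff Ip_def Im_def)
    have "countable N" by (simp add: N_def)
    then have N: "N \<in> sets borel" "emeasure lborel N = 0"
      by (auto intro: emeasure_lborel_countable countable_imp_null_set_lborel[THEN null_setsD2] simp flip: sets_lborel)
    define A where "A = (\<lambda>(p, t). \<Sum>k. cost_density \<beta> (cell_mass P L Tp (Suc k) p) * indicator (Ip k) t)"
    define B where "B = (\<lambda>(p, t). \<Sum>k. cost_density \<beta> (cell_mass P L Tm (Suc k) p) * indicator (Im k) t)"
    \<comment> \<open>Infinite at the break points, so that the comparison below holds at every
      \<open>(p, t)\<close>, yet with integral 0 because \<open>N\<close> is countable.\<close>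
    define Z where "Z = (\<lambda>(p :: 'g, t). top * indicator N t :: ennreal)"
    have [measurable]: "A \<in> borel_measurable (P \<Otimes>\<^sub>M ?U)" "B \<in> borel_measurable (P \<Otimes>\<^sub>M ?U)"
      unfolding A_def B_def by measurable
    have NU [measurable]: "N \<inter> {0..1} \<in> sets ?U"
      using N by (auto simp: sets_restrict_space)
    have Z_eq: "Z z = top * indicator (N \<inter> {0..1}) (snd z)" if "z \<in> space (P \<Otimes>\<^sub>M ?U)" for z
      using that by (auto simp: Z_def space_pair_measure space_restrict_space indicator_def split: prod.splits)
    have Z_meas [measurable]: "Z \<in> borel_measurable (P \<Otimes>\<^sub>M ?U)"
      by (subst measurable_cong[OF Z_eq]) (assumption, measurable)
    have "emeasure lborel (N \<inter> {0..1}) = 0"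
      using N(1) by (intro emeasure_eq_0[OF _ N(2)]) simp_all
    then have "emeasure ?U (N \<inter> {0..1}) = 0"
      by (simp add: emeasure_restrict_space)
    then have "(\<integral>\<^sup>+ z. top * indicator (N \<inter> {0..1}) (snd z) \<partial>(P \<Otimes>\<^sub>M ?U)) = 0"
      by (subst U.nn_integral_fst[symmetric]) (simp_all add: nn_integral_cmult_indicator)
    then have Z0: "(\<integral>\<^sup>+ z. Z z \<partial>(P \<Otimes>\<^sub>M ?U)) = 0"
      by (simp add: Z_eq cong: nn_integral_cong_simp)

    have "J_tau \<tau> P \<gamma> \<le> (\<integral>\<^sup>+ z. ennreal (2 * K) * (A z + B z) + Z z \<partial>(P \<Otimes>\<^sub>M ?U))"
      unfolding J_tau_def
    proof (rule nn_integral_mono, clarify)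
      fix p t assume "(p, t) \<in> space (P \<Otimes>\<^sub>M ?U)"
      then have p: "p \<in> space P" and t01: "t \<in> {0..1}"
        by (auto simp: space_pair_measure space_restrict_space)
      let ?J = "r_tau \<tau> (multiplicity_pat P \<gamma> (\<gamma> (p, t))) *
        ennreal (norm (vector_derivative (\<lambda>s. \<gamma> (p, s)) (at t within {0..1})))"
      have term_le: "f k \<le> (\<Sum>k. f k)" for f :: "nat \<Rightarrow> ennreal" and k
        using sum_le_suminf[of f "{k}"] by simp
      \<comment> \<open>\<open>N\<close> contains 1/2 because \<open>dyadic_time 0 = 0\<close>, and
        the end points 0 and 1, where the slots accumulate, by definition.\<close>
      consider "t \<in> N" | "t \<notin> N" "0 < t" "t < 1/2" | "t \<notin> N" "1/2 < t" "t < 1"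
      proof -
        have "(1 + dyadic_time 0) / 2 \<in> N"
          unfolding N_def by blast
        then have half: "1/2 \<in> N"
          by simp
        have "t \<notin> N \<Longrightarrow> t \<noteq> 1/2"
          using half by blast
        moreover have "t \<notin> N \<Longrightarrow> t \<noteq> 0" "t \<notin> N \<Longrightarrow> t \<noteq> 1"
          by (auto simp: N_def)
        ultimately show ?thesis
          using that t01 by (cases "t \<in> N"; cases "t < 1/2") auto
      qed
      then show "?J \<le> ennreal (2 * K) * (A (p, t) + B (p, t)) + Z (p, t)"
      proof cases
        case 1
        then show ?thesis by (simp add: Z_def)
      next
        case 2
        then obtain k where k: "dyadic_time k \<le> 1 - 2 * t" "1 - 2 * t < dyadic_time (Suc k)"
          using ex_dyadic_time_interval[of "1 - 2 * t"] by auto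
        have "1 - 2 * t \<noteq> dyadic_time k"
        proof
          assume "1 - 2 * t = dyadic_time k"
          then have "t = (1 - dyadic_time k) / 2" by simp
          then show False using 2 by (simp add: N_def)
        qed
        with k have k': "dyadic_time k < 1 + (-2) * t" "1 + (-2) * t < dyadic_time (Suc k)" by auto
        \<comment> \<open>On \<open>{0<..<1/2}\<close> the second summand of \<open>\<gamma>\<close>
          rests at the root, so the path has the required form with \<open>b = 1\<close> and
          \<open>c = -2\<close>.\<close>
        have "?J \<le> ennreal (4 * real DIM('a) * L) * cost_density \<beta> (cell_mass P L Tp (Suc k) p)"
          using 2 by (intro plus.cost_integrand_le[OF \<beta>(3) hit, where S="{0<..<1/2}", OF _ _ _ _ _ k' _ p])
            (auto simp: \<gamma>_def)
        also have "4 * real DIM('a) * L = 2 * K" by (simp add: K_def)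
        finally have J: "?J \<le> ennreal (2 * K) * cost_density \<beta> (cell_mass P L Tp (Suc k) p)" .
        have "t \<in> Ip k"
          using k' by (simp add: Ip_def field_simps)
        then have "cost_density \<beta> (cell_mass P L Tp (Suc k) p) \<le> A (p, t)"
          using term_le[of "\<lambda>k. cost_density \<beta> (cell_mass P L Tp (Suc k) p) * indicator (Ip k) t" k]
          by (simp add: A_def)
        also have "A (p, t) \<le> A (p, t) + B (p, t)"
          by simp
        finally have "ennreal (2 * K) * cost_density \<beta> (cell_mass P L Tp (Suc k) p)
            \<le> ennreal (2 * K) * (A (p, t) + B (p, t))"
          by (rule mult_left_mono) simp
        also have "\<dots> \<le> ennreal (2 * K) * (A (p, t) + B (p, t)) + Z (p, t)"
          by simp
        finally show ?thesis
          using J by (rule order_trans[rotated])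
      next
        case 3
        then obtain k where k: "dyadic_time k \<le> 2 * t - 1" "2 * t - 1 < dyadic_time (Suc k)"
          using ex_dyadic_time_interval[of "2 * t - 1"] by auto
        have "2 * t - 1 \<noteq> dyadic_time k"
        proof
          assume "2 * t - 1 = dyadic_time k"
          then have "t = (1 + dyadic_time k) / 2" by simp
          then show False using 3 by (simp add: N_def)
        qed
        with k have k': "dyadic_time k < -1 + 2 * t" "-1 + 2 * t < dyadic_time (Suc k)" by auto
        have "?J \<le> ennreal (4 * real DIM('a) * L) * cost_density \<beta> (cell_mass P L Tm (Suc k) p)"
          using 3 by (intro minus.cost_integrand_le[OF \<beta>(3) hit, where S="{1/2<..<1}", OF _ _ _ _ _ k' _ p])
            (auto simp: \<gamma>_def)
        also have "4 * real DIM('a) * L = 2 * K" by (simp add: K_def)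
        finally have J: "?J \<le> ennreal (2 * K) * cost_density \<beta> (cell_mass P L Tm (Suc k) p)" .
        have "t \<in> Im k"
          using k' by (simp add: Im_def field_simps)
        then have "cost_density \<beta> (cell_mass P L Tm (Suc k) p) \<le> B (p, t)"
          using term_le[of "\<lambda>k. cost_density \<beta> (cell_mass P L Tm (Suc k) p) * indicator (Im k) t" k]
          by (simp add: B_def)
        also have "B (p, t) \<le> A (p, t) + B (p, t)"
          by simp
        finally have "ennreal (2 * K) * cost_density \<beta> (cell_mass P L Tm (Suc k) p)
            \<le> ennreal (2 * K) * (A (p, t) + B (p, t))"
          by (rule mult_left_mono) simp
        also have "\<dots> \<le> ennreal (2 * K) * (A (p, t) + B (p, t)) + Z (p, t)"
          by simp
        finally show ?thesis
          using J by (rule order_trans[rotated])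
      qed
    qed
    also have "\<dots> = ennreal (2 * K) * ((\<integral>\<^sup>+ z. A z \<partial>(P \<Otimes>\<^sub>M ?U)) + (\<integral>\<^sup>+ z. B z \<partial>(P \<Otimes>\<^sub>M ?U)))"
      by (simp add: nn_integral_add nn_integral_cmult Z0)
    also have "\<dots> < \<infinity>"
    proof -
      have "(\<integral>\<^sup>+ z. A z \<partial>(P \<Otimes>\<^sub>M ?U)) < \<infinity>"
        unfolding A_def by (rule plus.tree_integral_finite[OF int U.finite_measure_axioms meas(1) len(1)])
      moreover have "(\<integral>\<^sup>+ z. B z \<partial>(P \<Otimes>\<^sub>M ?U)) < \<infinity>"
        unfolding B_def by (rule minus.tree_integral_finite[OF int U.finite_measure_axioms meas(2) len(2)])
      ultimately show ?thesis by (simp add: ennreal_mult_less_top)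
    qed
    finally show ?thesis .
  qed
  ultimately have "irrigation_pattern P \<gamma> \<and> J_tau_bd \<tau> \<mu>p \<mu>m P \<gamma> < \<infinity>"
    by (simp add: J_tau_bd_def)
  then show ?thesis by blast
qed

end
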